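(* Let $G_1$ and $G_2$ be finite simple graphs on the vertex set $[d]=\{1,\ldots,d\}$. The following conditions are equivalent: (i) The lattice polytope $\Omega(\mathcal{Q}_{G_1},\mathcal{Q}_{G_2})$ possesses the integer decomposition property; (ii) The lattice polytope $\Omega(\mathcal{Q}_{G_1},\mathcal{Q}_{G_2})$ is reflexive and possesses the integer decomposition property; (iii) Both $G_1$ and $G_2$ are perfect.
   Context: A subset $W\subset[d]$ is stable in a graph $G$ on $[d]$ if no two distinct elements of $W$ are joined by an edge of $G$; $\emptyset$ and all singletons are stable. For $W\subset[d]$ let $\rho(W)=\sum_{j\in W}\mathbf{e}_j\in\mathbb{R}^d$ (so $\rho(\emptyset)=\mathbf{0}$), where $\mathbf{e}_1,\ldots,\mathbf{e}_d$ are the standard unit vectors. The stable set polytope $\mathcal{Q}_G\subset\mathbb{R}^d$ is the convex hull of $\{\rho(W): W \text{ stable in } G\}$. For $d$-dimensional lattice polytopes $\mathcal{P},\mathcal{Q}\subset\mathbb{R}^d$, $\Omega(\mathcal{P},\mathcal{Q})=\mathrm{conv}\{(\mathcal{P}\times\{1\})\cup(-\mathcal{Q}\times\{-1\})\}\subset\mathbb{R}^{d+1}$. A graph $G$ is perfect if for every induced subgraph $H$ (including $G$ itself) the chromatic number of $H$ equals the maximum cardinality of a clique of $H$. A lattice polytope $\mathcal{P}\subset\mathbb{R}^N$ of dimension $N$ is reflexive if the origin lies in its interior and the dual polytope $\{\mathbf{x}: \langle\mathbf{x},\mathbf{y}\rangle\le 1\ \forall \mathbf{y}\in\mathcal{P}\}$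 is a lattice polytope. $\mathcal{P}$ has the integer decomposition property if for every integer $n\ge1$ and every $\mathbf{a}\in n\mathcal{P}\cap\mathbb{Z}^N$ there exist $\mathbf{a}_1,\ldots,\mathbf{a}_n\in\mathcal{P}\cap\mathbb{Z}^N$ with $\mathbf{a}=\mathbf{a}_1+\cdots+\mathbf{a}_n$. *)

theory Defs
  imports "HOL-Analysis.Analysis"
begin

text \<open>
  A finite simple graph on the vertex set \<open>[d]\<close> is given by a finite type \<open>'n\<close> with
  \<open>d = CARD('n)\<close> and an edge relation \<open>E\<close> that contains both orientations of every edge.
\<close>

definition simple_graph :: "('n::finite \<times> 'n) set \<Rightarrow> bool" where
  "simple_graph E \<longleftrightarrow> sym E \<and> irrefl E"

definition stable :: "('n \<times> 'n) set \<Rightarrow> 'n set \<Rightarrow> bool" where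
  "stable E W \<longleftrightarrow> (\<forall>i\<in>W. \<forall>j\<in>W. i \<noteq> j \<longrightarrow> (i, j) \<notin> E)"

definition clique :: "('n \<times> 'n) set \<Rightarrow> 'n set \<Rightarrow> bool" where
  "clique E K \<longleftrightarrow> (\<forall>i\<in>K. \<forall>j\<in>K. i \<noteq> j \<longrightarrow> (i, j) \<in> E)"

definition proper_colouring :: "'n set \<Rightarrow> ('n \<times> 'n) set \<Rightarrow> nat \<Rightarrow> ('n \<Rightarrow> nat) \<Rightarrow> bool" where
  "proper_colouring V E k c \<longleftrightarrow>
    c ` V \<subseteq> {..<k} \<and> (\<forall>u\<in>V. \<forall>v\<in>V. (u, v) \<in> E \<longrightarrow> c u \<noteq> c v)"

definition chromatic_number :: "'n set \<Rightarrow> ('n \<times> 'n) set \<Rightarrow> nat" where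
  "chromatic_number V E = (LEAST k. \<exists>c. proper_colouring V E k c)"

definition clique_number :: "'n set \<Rightarrow> ('n \<times> 'n) set \<Rightarrow> nat" where
  "clique_number V E = Max (card ` {K. K \<subseteq> V \<and> clique E K})"

text \<open>
  \<open>Restr E H\<close> is the edge relation of the subgraph induced on \<open>H\<close>. The empty subgraph may be
  included because both of its invariants are \<open>0\<close>.
\<close>

definition perfect :: "('n::finite \<times> 'n) set \<Rightarrow> bool" where
  "perfect E \<longleftrightarrow> (\<forall>H. chromatic_number H (Restr E H) = clique_number H (Restr E H))"

text \<open>
  For the types used here, \<open>Basis\<close> is the standard basis, so these are the points of
  \<open>\<int>\<^sup>N\<close>, where \<open>N = DIM('a)\<close>.
\<close>

definition integer_points :: "'a::euclidean_space set" where
  "integer_points = {x. \<forall>b\<in>Basis. x \<bullet> b \<in> \<int>}"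

definition lattice_polytope :: "'a::euclidean_space set \<Rightarrow> bool" where
  "lattice_polytope P \<longleftrightarrow> (\<exists>V. finite V \<and> V \<subseteq> integer_points \<and> P = convex hull V)"

definition dual_polytope :: "'a::euclidean_space set \<Rightarrow> 'a set" where
  "dual_polytope P = {x. \<forall>y\<in>P. x \<bullet> y \<le> 1}"

definition reflexive_polytope :: "'a::euclidean_space set \<Rightarrow> bool" where
  "reflexive_polytope P \<longleftrightarrow>
    lattice_polytope P \<and> aff_dim P = int DIM('a) \<and> 0 \<in> interior P \<and>
    lattice_polytope (dual_polytope P)"

definition integer_decomposition_property :: "'a::euclidean_space set \<Rightarrow> bool" where
  "integer_decomposition_property P \<longleftrightarrow>
    (\<forall>n\<ge>1. \<forall>a \<in> (\<lambda>x. real n *\<^sub>R x) ` P \<inter> integer_points.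
      \<exists>f :: nat \<Rightarrow> 'a. (\<forall>i\<in>{1..n}. f i \<in> P \<inter> integer_points) \<and> a = (\<Sum>i=1..n. f i))"

definition rho :: "'n::finite set \<Rightarrow> real ^ 'n" where
  "rho W = (\<Sum>j\<in>W. axis j 1)"

definition stable_set_polytope :: "('n::finite \<times> 'n) set \<Rightarrow> (real ^ 'n) set" where
  "stable_set_polytope E = convex hull (rho ` {W. stable E W})"

text \<open>\<open>\<real>\<^sup>d\<^sup>+\<^sup>1\<close> is represented as \<open>\<real>\<^sup>d \<times> \<real>\<close>.\<close>

definition Omega :: "(real ^ 'n::finite) set \<Rightarrow> (real ^ 'n) set \<Rightarrow> ((real ^ 'n) \<times> real) set" where
  "Omega P Q = convex hull (P \<times> {1} \<union> (uminus ` Q) \<times> {-1})"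

end

(*
  Let chi(w) be the least number of stable sets of G1 whose indicator vectors sum to the
  nonnegative integer vector w. If 2 w is a sum of m stable sets, then (w, floor (m/2)) lies
  in a dilate of Omega(Q_G1, Q_G2), and the integer decomposition property writes w as a sum
  of floor (m/2) stable sets. So chi(2 w) = 2 chi(w), and chi is an integer-valued sublinear
  function. A discrete Hahn-Banach argument then gives an integral linear minorant of chi that
  is tight at a prescribed indicator vector; its coefficients are 0 or 1 and the ones among
  them form a clique, so G1 is perfect. Reflection in the origin exchanges G1 and G2.

  Conversely, by the weighted replication lemma a perfect graph admits a decomposition of w
  into k stable sets as soon as every clique has weight at most k in w. Applied to the positive
  and negative parts of a lattice point of a dilate this gives the integer decomposition
  property. After rounding it also shows that the antiblocker of the stable set polytope is
  the convex hull of the clique vectors, so the dual of Omega(Q_G1, Q_G2) is the convex hull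
  of the points (2 rho(K), -1) and (-2 rho(K'), 1) for cliques K of G1 and K' of G2.
*)

theory Submission
  imports Defs
begin

section \<open>Integer-valued sublinear functions and a discrete Hahn-Banach argument\<close>

lemma eventually_const_if_decseq_bounded:
  fixes g :: "nat \<Rightarrow> int"
  assumes "decseq g" "\<And>n. B \<le> g n"
  shows "\<exists>N. \<forall>n\<ge>N. g n = g N"
proof -
  obtain N where N: "\<forall>n. nat (g N - B) \<le> nat (g n - B)"
    using ex_has_least_nat[of "\<lambda>_. True" 0 "\<lambda>n. nat (g n - B)"] by auto
  have "g n = g N" if "n \<ge> N" for n
    using N[rule_format, of n] assms(2)[of n] assms(2)[of N] decseqD[OF assms(1) that] by linarith
  then show ?thesis by blast
qed

text \<open>Compatibility with doubling stands in for positive homogeneity: directional derivatives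
  are taken along powers of two. A ring as carrier lets integer multiples be written as products;
  the application is to \<open>int ^ 'n\<close>.\<close>

definition doubling_sublinear :: "('a::comm_ring_1 \<Rightarrow> int) \<Rightarrow> bool" where
  "doubling_sublinear p \<longleftrightarrow> (\<forall>u v. p (u + v) \<le> p u + p v) \<and> (\<forall>u. p (2 * u) = 2 * p u)"

lemma
  assumes "doubling_sublinear p"
  shows doubling_sublinear_add: "p (u + v) \<le> p u + p v"
    and doubling_sublinear_double: "p (2 * u) = 2 * p u"
    and doubling_sublinear_0: "p 0 = 0"
    and doubling_sublinear_power2: "p (2 ^ n * u) = 2 ^ n * p u"
    and doubling_sublinear_minus: "0 \<le> p u + p (- u)"
proof -
  show add: "p (u + v) \<le> p u + p v" and dbl: "p (2 * u) = 2 * p u" for u v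
    using assms by (auto simp: doubling_sublinear_def)
  show zero: "p 0 = 0" using dbl[of 0] by simp
  show "p (2 ^ n * u) = 2 ^ n * p u"
    by (induction n) (simp_all add: dbl mult.assoc)
  show "0 \<le> p u + p (- u)" using add[of u "- u"] zero by simp
qed

text \<open>
  The directional derivative of \<open>p\<close> at \<open>x\<close>: the values
  \<open>p (2\<^sup>N x + v) - 2\<^sup>N p x\<close> decrease in \<open>N\<close>
  and, being bounded integers, are eventually constant.
\<close>

lemma doubling_sublinear_derivative:
  fixes p :: "'a::comm_ring_1 \<Rightarrow> int"
  assumes p: "doubling_sublinear p"
  shows "\<exists>q. doubling_sublinear q \<and> (\<forall>v. q v \<le> p v) \<and> q x = p x \<and> q (- x) = - p x"
proof -
  define g where "g v N = p (2 ^ N * x + v) - 2 ^ N * p x" for v N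
  note add = doubling_sublinear_add[OF p] and dbl = doubling_sublinear_double[OF p]
    and pow = doubling_sublinear_power2[OF p]
  have dec: "decseq (g v)" for v
  proof (rule decseq_SucI)
    fix N
    have eq: "2 ^ Suc N * x + v = 2 ^ N * x + (2 ^ N * x + v)" by (simp add: algebra_simps)
    have "p (2 ^ Suc N * x + v) \<le> 2 ^ N * p x + p (2 ^ N * x + v)"
      using add[of "2 ^ N * x" "2 ^ N * x + v"] unfolding eq pow .
    moreover have "2 ^ Suc N * p x = 2 ^ N * p x + 2 ^ N * p x" by simp
    ultimately show "g v (Suc N) \<le> g v N" unfolding g_def by linarith
  qed
  have "\<exists>N. \<forall>n\<ge>N. g v n = g v N" for v
  proof (rule eventually_const_if_decseq_bounded[OF dec])
    fix N
    have "p (2 ^ N * x) \<le> p (2 ^ N * x + v) + p (- v)" using add[of "2 ^ N * x + v" "- v"] by simp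
    then show "- p (- v) \<le> g v N" using pow[of N x] by (simp add: g_def)
  qed
  then obtain M where M: "\<And>v n. n \<ge> M v \<Longrightarrow> g v n = g v (M v)" by metis
  define q where "q v = g v (M v)" for v
  have q: "q v = g v n" if "n \<ge> M v" for v n using M[OF that] by (simp add: q_def)
  have q_le: "q v \<le> g v n" for v n
  proof (cases "n \<le> M v")
    case True then show ?thesis using decseqD[OF dec] by (simp add: q_def)
  next
    case False then show ?thesis using q[of v n] by simp
  qed
  have "q (u + v) \<le> q u + q v" for u v
  proof -
    define n where "n = max (M u) (M v)"
    have "q u = g u n" "q v = g v n" by (rule q; simp add: n_def)+
    moreover have "q (u + v) \<le> g (u + v) (Suc n)" by (rule q_le)
    \<comment> \<open>Each summand takes its own copy of \<open>2 ^ n * x\<close>, so the sum is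
      evaluated at index \<open>Suc n\<close>; doubling shifts the index in the same way.\<close>
    moreover have eq: "2 ^ Suc n * x + (u + v) = (2 ^ n * x + u) + (2 ^ n * x + v)"
      by (simp add: algebra_simps)
    have "g (u + v) (Suc n) \<le> g u n + g v n"
      using add[of "2 ^ n * x + u" "2 ^ n * x + v"] unfolding g_def eq by simp
    ultimately show ?thesis by linarith
  qed
  moreover have "q (2 * u) = 2 * q u" for u
  proof -
    define n where "n = max (M u) (M (2 * u))"
    have "q u = g u n" "q (2 * u) = g (2 * u) (Suc n)" by (rule q; simp add: n_def)+
    moreover have eq: "2 ^ Suc n * x + 2 * u = 2 * (2 ^ n * x + u)"
      by (simp add: algebra_simps)
    have "g (2 * u) (Suc n) = 2 * g u n" unfolding g_def eq dbl by simp
    ultimately show ?thesis by linarith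
  qed
  ultimately have dq: "doubling_sublinear q" by (simp add: doubling_sublinear_def)
  have le: "q v \<le> p v" for v using q_le[of v 0] add[of x v] by (simp add: g_def)
  \<comment> \<open>Here \<open>g (- x) 1\<close> equals \<open>p (2 * x - x) - 2 * p x\<close>,
    which is \<open>- p x\<close>.\<close>
  have "q (- x) \<le> - p x" using q_le[of "- x" 1] by (simp add: g_def)
  moreover have "0 \<le> q x + q (- x)" by (rule doubling_sublinear_minus[OF dq])
  ultimately have "q x = p x" "q (- x) = - p x" using le[of x] by linarith+
  then show ?thesis using dq le by blast
qed

text \<open>The derivative is taken at \<open>w\<close> and then at each point of \<open>B\<close>
  in turn. Oddness once gained survives passage to a smaller \<open>r\<close>: the upper bounds on
  \<open>r x\<close> and \<open>r (- x)\<close> add up to 0 while \<open>r x + r (- x)\<close> is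
  nonnegative, so both bounds are attained.\<close>

lemma doubling_sublinear_minorant:
  fixes p :: "'a::comm_ring_1 \<Rightarrow> int"
  assumes p: "doubling_sublinear p" and "finite B"
  shows "\<exists>q. doubling_sublinear q \<and> (\<forall>v. q v \<le> p v) \<and> q w = p w \<and> (\<forall>x\<in>B. q (- x) = - q x)"
proof -
  have "\<exists>q. doubling_sublinear q \<and> (\<forall>v. q v \<le> p v) \<and> q w = p w \<and>
          (\<forall>x\<in>insert w B. q (- x) = - q x)"
    using \<open>finite B\<close>
  proof (induction B rule: finite_induct)
    case empty
    then show ?case using doubling_sublinear_derivative[OF p, of w] by auto
  next
    case (insert b B)
    then obtain q where q: "doubling_sublinear q" "\<forall>v. q v \<le> p v" "q w = p w"
      "\<And>x. x \<in> insert w B \<Longrightarrow> q (- x) = - q x" by blast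
    obtain r where r: "doubling_sublinear r" "\<And>v. r v \<le> q v" "r b = q b" "r (- b) = - q b"
      using doubling_sublinear_derivative[OF q(1), of b] by auto
    have "r x = q x \<and> r (- x) = - q x" if "x \<in> insert w B" for x
      using r(2)[of x] r(2)[of "- x"] q(4)[OF that] doubling_sublinear_minus[OF r(1), of x]
      by linarith
    then have *: "r x = q x" "r (- x) = - q x" if "x \<in> insert w B" for x using that by auto
    have "r (- x) = - r x" if "x \<in> insert w (insert b B)" for x
      using that * r(3,4) by (metis insert_iff)
    moreover have "r v \<le> p v" for v using r(2) q(2) order_trans by blast
    ultimately show ?case using r(1) *(1)[of w] q(3) by (metis insertI1)
  qed
  then show ?thesis by blast
qed

lemma doubling_sublinear_sum:
  fixes q :: "'a::comm_ring_1 \<Rightarrow> int"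
  assumes q: "doubling_sublinear q" and lin: "\<And>x. x \<in> e ` A \<Longrightarrow> q (- x) = - q x" and "finite A"
  shows "q (\<Sum>j\<in>A. of_nat (n j) * e j) = (\<Sum>j\<in>A. int (n j) * q (e j))"
proof -
  \<comment> \<open>Subadditivity for \<open>u + x\<close> and for
    \<open>u = (u + x) + (- x)\<close> gives the two inequalities, since
    \<open>q (- x) = - q x\<close>.\<close>
  have 1: "q (u + x) = q u + q x" if "x \<in> e ` A" for u x
    using doubling_sublinear_add[OF q, of u x] doubling_sublinear_add[OF q, of "u + x" "- x"] lin[OF that]
    by simp
  have 2: "q (u + of_nat k * x) = q u + int k * q x" if "x \<in> e ` A" for u k x
  proof (induction k)
    case (Suc k)
    have "u + of_nat (Suc k) * x = (u + of_nat k * x) + x" by (simp add: algebra_simps)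
    then show ?case using Suc 1[OF that, of "u + of_nat k * x"] by (simp add: algebra_simps)
  qed simp
  have "q (\<Sum>j\<in>C. of_nat (n j) * e j) = (\<Sum>j\<in>C. int (n j) * q (e j))" if "C \<subseteq> A" for C
    using finite_subset[OF that \<open>finite A\<close>] that
  proof (induction C rule: finite_induct)
    case empty
    then show ?case by (simp add: doubling_sublinear_0[OF q])
  next
    case (insert j C)
    then show ?case
      using 2[of "e j" "\<Sum>j\<in>C. of_nat (n j) * e j" "n j"] by (simp add: add.commute)
  qed
  then show ?thesis by blast
qed

section \<open>Weighted colourings by stable sets\<close>

definition multiplicity_in :: "'n set list \<Rightarrow> 'n \<Rightarrow> nat" where
  "multiplicity_in Ss j = (\<Sum>S\<leftarrow>Ss. of_bool (j \<in> S))"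

text \<open>A list lets a stable set, the empty one included, occur repeatedly, so that extra
  colours can be added as padding. Weights 0 and 1 correspond to ordinary colourings of induced
  subgraphs.\<close>

definition multicolourable :: "('n \<times> 'n) set \<Rightarrow> nat \<Rightarrow> ('n \<Rightarrow> nat) \<Rightarrow> bool" where
  "multicolourable E k w \<longleftrightarrow>
    (\<exists>Ss. length Ss = k \<and> (\<forall>S\<in>set Ss. stable E S) \<and> w = multiplicity_in Ss)"

lemma multiplicity_in_Nil [simp]: "multiplicity_in [] = (\<lambda>_. 0)"
  and multiplicity_in_Cons [simp]:
    "multiplicity_in (S # Ss) = (\<lambda>j. of_bool (j \<in> S) + multiplicity_in Ss j)"
  and multiplicity_in_append [simp]:
    "multiplicity_in (Ss @ Ts) = (\<lambda>j. multiplicity_in Ss j + multiplicity_in Ts j)"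
  by (auto simp: multiplicity_in_def fun_eq_iff)

lemma stable_empty [simp]: "stable E {}"
  by (simp add: stable_def)

lemma stable_subset: "stable E S \<Longrightarrow> T \<subseteq> S \<Longrightarrow> stable E T"
  unfolding stable_def by blast

lemma clique_subset: "clique E K \<Longrightarrow> L \<subseteq> K \<Longrightarrow> clique E L"
  unfolding clique_def by blast

lemma card_stable_Int_clique:
  assumes "stable E S" "clique E K"
  shows "card (S \<inter> K) \<le> 1"
proof -
  have "\<exists>x. S \<inter> K \<subseteq> {x}" using assms unfolding stable_def clique_def by blast
  then show ?thesis by (metis card.empty card.insert card_mono empty_iff finite.intros One_nat_def)
qed

lemma sum_multiplicity_in:
  "finite K \<Longrightarrow> sum (multiplicity_in Ss) K = (\<Sum>S\<leftarrow>Ss. card (S \<inter> K))"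
  by (induction Ss) (auto simp: sum.distrib sum.If_cases of_bool_def Int_commute)

lemma multicolourable_0 [simp]: "multicolourable E 0 w \<longleftrightarrow> w = (\<lambda>_. 0)"
  by (auto simp: multicolourable_def)

lemma multicolourable_Cons:
  assumes "multicolourable E k w" "stable E S"
  shows "multicolourable E (Suc k) (\<lambda>j. of_bool (j \<in> S) + w j)"
proof -
  obtain Ss where "length Ss = k" "\<forall>S\<in>set Ss. stable E S" "w = multiplicity_in Ss"
    using assms(1) by (auto simp: multicolourable_def)
  then show ?thesis using assms(2)
    by (auto simp: multicolourable_def intro!: exI[of _ "S # Ss"])
qed

lemma multicolourable_add:
  assumes "multicolourable E k v" "multicolourable E l w"
  shows "multicolourable E (k + l) (\<lambda>j. v j + w j)"
proof -
  obtain Ss Ts where "length Ss = k" "\<forall>S\<in>set Ss. stable E S" "v = multiplicity_in Ss"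
    "length Ts = l" "\<forall>S\<in>set Ts. stable E S" "w = multiplicity_in Ts"
    using assms by (auto simp: multicolourable_def)
  then show ?thesis
    by (auto simp: multicolourable_def intro!: exI[of _ "Ss @ Ts"])
qed

text \<open>The first stable set is cut down to the vertices where \<open>v\<close> is positive;
  what remains of \<open>v\<close> is then dominated by the multiplicities of the other sets, and
  induction applies.\<close>

lemma multicolourable_mono:
  assumes "multicolourable E k w" "\<And>j. v j \<le> w j"
  shows "multicolourable E k v"
  using assms
proof (induction k arbitrary: v w)
  case 0
  then show ?case by (auto simp: fun_eq_iff)
next
  case (Suc k)
  then obtain Ss where Ss: "length Ss = Suc k" "\<forall>S\<in>set Ss. stable E S" "w = multiplicity_in Ss"
    by (auto simp: multicolourable_def)
  then obtain S Ts where S: "Ss = S # Ts" by (cases Ss) auto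
  define T where "T = {j \<in> S. v j > 0}"
  have "stable E T" using Ss(2) S stable_subset[of E S T] by (auto simp: T_def)
  moreover have "multicolourable E k (\<lambda>j. v j - of_bool (j \<in> T))"
  proof (rule Suc.IH)
    show "multicolourable E k (multiplicity_in Ts)"
      using Ss S by (auto simp: multicolourable_def)
    show "v j - of_bool (j \<in> T) \<le> multiplicity_in Ts j" for j
      using Suc.prems(2)[of j] Ss(3) S by (auto simp: T_def)
  qed
  ultimately have "multicolourable E (Suc k) (\<lambda>j. of_bool (j \<in> T) + (v j - of_bool (j \<in> T)))"
    using multicolourable_Cons[of E k "\<lambda>j. v j - of_bool (j \<in> T)" T] by simp
  moreover have "(\<lambda>j. of_bool (j \<in> T) + (v j - of_bool (j \<in> T))) = v"
    by (auto simp: T_def fun_eq_iff)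
  ultimately show ?case by simp
qed

lemma multicolourable_le:
  assumes "multicolourable E k w" "k \<le> l"
  shows "multicolourable E l w"
  using assms(2,1)
proof (induction l rule: dec_induct)
  case (step n)
  then show ?case using multicolourable_Cons[of E n w "{}"] by simp
qed simp

text \<open>Weak duality between colours and cliques: each of the \<open>k\<close> stable sets
  contributes at most 1 to the weight of a clique.\<close>

lemma multicolourable_clique:
  assumes "multicolourable E k w" "clique E K" "finite K"
  shows "sum w K \<le> k"
proof -
  obtain Ss where Ss: "length Ss = k" "\<forall>S\<in>set Ss. stable E S" "w = multiplicity_in Ss"
    using assms(1) by (auto simp: multicolourable_def)
  have "sum w K = (\<Sum>S\<leftarrow>Ss. card (S \<inter> K))" using Ss(3) assms(3) by (simp add: sum_multiplicity_in)
  also have "\<dots> \<le> (\<Sum>S\<leftarrow>Ss. 1)"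
    using Ss(2) assms(2) by (intro sum_list_mono card_stable_Int_clique) auto
  finally show ?thesis using Ss(1) by (simp add: sum_list_triv)
qed

section \<open>Chromatic number, clique number and the replication lemma\<close>

lemma proper_colouring_multicolourable:
  assumes "proper_colouring H (Restr E H) k c"
  shows "multicolourable E k (\<lambda>j. of_bool (j \<in> H))"
proof -
  define Ss where "Ss = map (\<lambda>i. {j \<in> H. c j = i}) [0..<k]"
  have "\<forall>S\<in>set Ss. stable E S"
    using assms by (fastforce simp: Ss_def stable_def proper_colouring_def)
  moreover have "of_bool (j \<in> H) = multiplicity_in Ss j" for j
  proof -
    have "multiplicity_in Ss j = (\<Sum>i\<in>{0..<k}. of_bool (j \<in> H \<and> c j = i))"
      by (simp add: multiplicity_in_def Ss_def o_def interv_sum_list_conv_sum_set_nat)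
    also have "\<dots> = of_bool (j \<in> H)"
    proof (cases "j \<in> H")
      case True
      then have "c j < k" using assms by (auto simp: proper_colouring_def)
      then show ?thesis using True by (simp add: of_bool_def)
    qed simp
    finally show ?thesis by simp
  qed
  ultimately show ?thesis unfolding multicolourable_def
    by (intro exI[of _ Ss]) (auto simp: Ss_def)
qed

text \<open>A vertex is coloured by the position of a list entry containing it. Adjacent vertices
  are distinct by irreflexivity, so no stable entry holds both.\<close>

lemma multicolourable_proper_colouring:
  assumes "multicolourable E k (\<lambda>j. of_bool (j \<in> H))" "irrefl E"
  shows "\<exists>c. proper_colouring H (Restr E H) k c"
proof -
  obtain Ss where Ss: "length Ss = k" "\<forall>S\<in>set Ss. stable E S"
    "(\<lambda>j. of_bool (j \<in> H)) = multiplicity_in Ss"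
    using assms(1) by (auto simp: multicolourable_def)
  have "\<exists>i<k. j \<in> Ss ! i" if "j \<in> H" for j
  proof (rule ccontr)
    assume "\<not> ?thesis"
    then have "j \<notin> S" if "S \<in> set Ss" for S using that Ss(1) by (metis in_set_conv_nth)
    then have "multiplicity_in Ss j = 0" by (auto simp: multiplicity_in_def sum_list_eq_0_iff)
    then show False using fun_cong[OF Ss(3), of j] \<open>j \<in> H\<close> by simp
  qed
  then obtain c where c: "\<And>j. j \<in> H \<Longrightarrow> c j < k \<and> j \<in> Ss ! c j" by metis
  have "c u \<noteq> c v" if "u \<in> H" "v \<in> H" "(u, v) \<in> E" for u v
  proof
    assume "c u = c v"
    then have "u \<in> Ss ! c u" "v \<in> Ss ! c u" "stable E (Ss ! c u)"
      using c[OF that(1)] c[OF that(2)] Ss(1,2) by auto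
    moreover have "u \<noteq> v" using that(3) assms(2) by (auto simp: irrefl_def)
    ultimately show False using that(3) by (auto simp: stable_def)
  qed
  then show ?thesis using c by (intro exI[of _ c]) (auto simp: proper_colouring_def)
qed

lemma exists_proper_colouring:
  fixes E :: "('n::finite \<times> 'n) set"
  assumes "irrefl E"
  shows "\<exists>k c. proper_colouring H (Restr E H) k c"
proof -
  obtain f :: "'n \<Rightarrow> nat" where f: "f ` UNIV = {..<CARD('n)}" "inj f"
    using ex_bij_betw_finite_nat[of "UNIV :: 'n set"]
    by (auto simp: bij_betw_def atLeast0LessThan)
  have "proper_colouring H (Restr E H) CARD('n) f"
    using f assms by (auto simp: proper_colouring_def irrefl_def inj_def)
  then show ?thesis by blast
qed

lemma chromatic_number_le_iff:
  fixes E :: "('n::finite \<times> 'n) set"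
  assumes "irrefl E"
  shows "chromatic_number H (Restr E H) \<le> k \<longleftrightarrow> multicolourable E k (\<lambda>j. of_bool (j \<in> H))"
proof
  have "\<exists>c. proper_colouring H (Restr E H) (chromatic_number H (Restr E H)) c"
    unfolding chromatic_number_def by (rule LeastI_ex[OF exists_proper_colouring[OF assms]])
  then show "multicolourable E k (\<lambda>j. of_bool (j \<in> H))" if "chromatic_number H (Restr E H) \<le> k"
    using proper_colouring_multicolourable multicolourable_le that by blast
  show "chromatic_number H (Restr E H) \<le> k" if "multicolourable E k (\<lambda>j. of_bool (j \<in> H))"
    unfolding chromatic_number_def
    by (rule Least_le) (rule multicolourable_proper_colouring[OF that assms])
qed

lemma clique_number_le_iff:
  fixes E :: "('n::finite \<times> 'n) set"
  shows "clique_number H (Restr E H) \<le> k \<longleftrightarrow> (\<forall>K. clique E K \<and> K \<subseteq> H \<longrightarrow> card K \<le> k)"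
proof -
  have "{K. K \<subseteq> H \<and> clique (Restr E H) K} = {K. clique E K \<and> K \<subseteq> H}"
    by (auto simp: clique_def)
  moreover have "{} \<in> {K. clique E K \<and> K \<subseteq> H}" by (simp add: clique_def)
  ultimately show ?thesis unfolding clique_number_def by (subst Max_le_iff) auto
qed

text \<open>
  Lovasz's replication lemma in weighted form. If \<open>w v \<ge> 2\<close>, decrease \<open>w\<close> at \<open>v\<close> and take
  from a multicolouring of the result a stable set \<open>S\<close> through \<open>v\<close>; removing \<open>S\<close> from \<open>w\<close>
  lowers the maximum clique weight.
\<close>

lemma perfect_imp_multicolourable:
  fixes E :: "('n::finite \<times> 'n) set"
  assumes "irrefl E" "perfect E" "\<And>K. clique E K \<Longrightarrow> sum w K \<le> k"
  shows "multicolourable E k w"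
  using assms(3)
proof (induction "sum w UNIV" arbitrary: w k rule: less_induct)
  case less
  show ?case
  proof (cases "\<exists>v. w v \<ge> 2")
    case False
    \<comment> \<open>The weights are now 0 or 1, so \<open>w\<close> is the indicator of
      \<open>H\<close> and perfection applies to the subgraph induced on \<open>H\<close>.\<close>
    define H where "H = {j. w j = 1}"
    have w: "w = (\<lambda>j. of_bool (j \<in> H))"
    proof
      fix j show "w j = of_bool (j \<in> H)" using False[simplified, rule_format, of j]
        by (auto simp: H_def)
    qed
    have "clique_number H (Restr E H) \<le> k"
      unfolding clique_number_le_iff
    proof (intro allI impI)
      fix K assume K: "clique E K \<and> K \<subseteq> H"
      then have "sum w K = card K" by (auto simp: H_def subset_iff)
      then show "card K \<le> k" using less.prems K by metis
    qed
    then have "chromatic_number H (Restr E H) \<le> k"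
      using assms(2) by (simp add: perfect_def)
    then show ?thesis using chromatic_number_le_iff[OF assms(1)] w by simp
  next
    case True
    then obtain v where v: "w v \<ge> 2" by blast
    define w' where "w' = w(v := w v - 1)"
    have w_eq: "sum w K = sum w' K + of_bool (v \<in> K)" for K
    proof -
      have "sum w K = (\<Sum>j\<in>K. w' j + of_bool (j = v))"
        using v by (intro sum.cong) (auto simp: w'_def)
      then show ?thesis by (simp add: sum.distrib of_bool_def)
    qed
    have "multicolourable E k w'"
    proof (rule less.hyps)
      show "sum w' UNIV < sum w UNIV" using w_eq[of UNIV] by simp
      show "sum w' K \<le> k" if "clique E K" for K using w_eq[of K] less.prems[OF that] by simp
    qed
    then obtain Ss where Ss: "length Ss = k" "\<forall>S\<in>set Ss. stable E S" "w' = multiplicity_in Ss"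
      by (auto simp: multicolourable_def)
    have "\<exists>S\<in>set Ss. v \<in> S"
    proof (rule ccontr)
      assume "\<not> ?thesis"
      then have "w' v = 0" unfolding Ss(3) by (auto simp: multiplicity_in_def sum_list_eq_0_iff)
      then show False using v by (simp add: w'_def)
    qed
    then obtain S where S: "S \<in> set Ss" "v \<in> S" by blast
    have Sw: "of_bool (j \<in> S) \<le> w j" for j
    proof (cases "j \<in> S")
      case True
      then have "w' j \<noteq> 0" using S(1) unfolding Ss(3)
        by (auto simp: multiplicity_in_def sum_list_eq_0_iff)
      then show ?thesis by (auto simp: w'_def split: if_splits)
    qed simp
    \<comment> \<open>\<open>S\<close> lies in the support of \<open>w\<close>, so this truncated
      subtraction is exact.\<close>
    define u where "u j = w j - of_bool (j \<in> S)" for j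
    have u_eq: "sum w K = sum u K + card (S \<inter> K)" for K
    proof -
      have "sum w K = (\<Sum>j\<in>K. u j + of_bool (j \<in> S))"
        using Sw by (intro sum.cong) (auto simp: u_def)
      then show ?thesis by (simp add: sum.distrib sum.If_cases of_bool_def Int_commute)
    qed
    have "k \<ge> 1" using Ss(1) S(1) by (cases Ss) auto
    have "multicolourable E (k - 1) u"
    proof (rule less.hyps)
      have "card (S \<inter> UNIV) \<noteq> 0" using S(2) by auto
      then show "sum u UNIV < sum w UNIV" using u_eq[of UNIV] by linarith
      fix K assume K: "clique E K"
      have le1: "card (T \<inter> K) \<le> 1" if "T \<in> set Ss" for T
        using card_stable_Int_clique Ss(2) K that by blast
      \<comment> \<open>A clique that meets \<open>S\<close> loses weight 1. A clique that misses
        \<open>S\<close> also misses \<open>v\<close>, so its weight is the same in \<open>w\<close>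
        and \<open>w'\<close> and is supplied by the other \<open>k - 1\<close> stable sets.\<close>
      show "sum u K \<le> k - 1"
      proof (cases "card (S \<inter> K) = 0")
        case False
        then show ?thesis using u_eq[of K] less.prems[OF K] by linarith
      next
        case True
        obtain Xs Ys where XY: "Ss = Xs @ S # Ys" using S(1) by (meson split_list)
        have "sum w' K = (\<Sum>T\<leftarrow>Ss. card (T \<inter> K))" by (simp add: Ss(3) sum_multiplicity_in)
        also have "\<dots> = (\<Sum>T\<leftarrow>Xs @ Ys. card (T \<inter> K))" using True XY by simp
        also have "\<dots> \<le> (\<Sum>T\<leftarrow>Xs @ Ys. 1)" by (rule sum_list_mono) (use le1 XY in auto)
        also have "\<dots> = k - 1" using XY Ss(1) by (simp add: sum_list_triv)
        finally have "sum w' K \<le> k - 1" .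
        moreover have "v \<notin> K" using True S(2) by auto
        ultimately show ?thesis using u_eq[of K] w_eq[of K] True by simp
      qed
    qed
    moreover have "stable E S" using Ss(2) S(1) by blast
    ultimately have "multicolourable E (Suc (k - 1)) (\<lambda>j. of_bool (j \<in> S) + u j)"
      by (rule multicolourable_Cons)
    moreover have "(\<lambda>j. of_bool (j \<in> S) + u j) = w" using Sw by (auto simp: u_def fun_eq_iff)
    ultimately show ?thesis using \<open>k \<ge> 1\<close> by simp
  qed
qed

section \<open>Perfection from the halving of multicolourings\<close>

text \<open>Every unit of weight can receive its own singleton; hence the least number of colours is
  well defined.\<close>

lemma exists_multicolourable:
  fixes E :: "('n::finite \<times> 'n) set"
  shows "\<exists>k. multicolourable E k w"
proof (induction "sum w UNIV" arbitrary: w)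
  case 0
  then have "w = (\<lambda>_. 0)" by auto
  then show ?case using multicolourable_0 by blast
next
  case (Suc n)
  then obtain v where v: "w v > 0" by (metis gr0I sum.neutral nat.distinct(1))
  define u where "u = w(v := w v - 1)"
  have w: "w = (\<lambda>j. of_bool (j \<in> {v}) + u j)" using v by (auto simp: u_def fun_eq_iff)
  then have "sum w UNIV = Suc (sum u UNIV)" by (simp add: sum.distrib of_bool_def)
  then obtain k where "multicolourable E k u" using Suc by auto
  then have "multicolourable E (Suc k) w"
    using multicolourable_Cons[of E k u "{v}"] w by (simp add: stable_def)
  then show ?case by blast
qed

text \<open>
  The least \<open>k\<close> for which \<open>w\<close> is multicolourable is a subadditive integer function of \<open>w\<close>;
  under the hypothesis it is compatible with doubling, so that it has a linear minorant with
  integer coefficients touching it at the indicator of \<open>H\<close>. The coefficients are \<open>0\<close> or \<open>1\<close>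
  and their support is a clique.
\<close>

lemma perfect_if_multicolourable_halving:
  fixes E :: "('n::finite \<times> 'n) set"
  assumes E: "simple_graph E"
    and half: "\<And>m w. multicolourable E m (\<lambda>j. 2 * w j) \<Longrightarrow> multicolourable E (m div 2) w"
  shows "perfect E"
  unfolding perfect_def
proof
  fix H
  have irr: "irrefl E" and "sym E" using E by (auto simp: simple_graph_def)
  define mc where "mc w = (LEAST k. multicolourable E k w)" for w
  have chi_le: "mc w \<le> k \<longleftrightarrow> multicolourable E k w" for w k
  proof
    have "multicolourable E (mc w) w"
      unfolding mc_def by (rule LeastI_ex[OF exists_multicolourable])
    then show "multicolourable E k w" if "mc w \<le> k" using that multicolourable_le by blast
    show "mc w \<le> k" if "multicolourable E k w" unfolding mc_def using that by (rule Least_le)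
  qed
  have chi: "multicolourable E (mc w) w" for w using chi_le by blast
  \<comment> \<open>\<open>nat\<close> truncates negative coordinates to 0. This extends the colour
    number to all integer vectors and makes \<open>p\<close> vanish at the negatives of unit
    vectors, whence the coefficients of \<open>q\<close> are nonnegative.\<close>
  define p where "p v = int (mc (\<lambda>j. nat (v $ j)))" for v :: "int ^ 'n"
  have "doubling_sublinear p"
    unfolding doubling_sublinear_def
  proof (intro conjI allI)
    fix u v :: "int ^ 'n"
    have "multicolourable E (mc (\<lambda>j. nat (u $ j)) + mc (\<lambda>j. nat (v $ j))) (\<lambda>j. nat (u $ j) + nat (v $ j))"
      by (intro multicolourable_add chi)
    then have "multicolourable E (mc (\<lambda>j. nat (u $ j)) + mc (\<lambda>j. nat (v $ j))) (\<lambda>j. nat ((u + v) $ j))"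
      by (rule multicolourable_mono) simp
    then show "p (u + v) \<le> p u + p v" by (simp add: p_def flip: chi_le of_nat_add)
  next
    fix u :: "int ^ 'n"
    let ?u = "\<lambda>j. nat (u $ j)"
    have eq: "(\<lambda>j. nat ((2 * u) $ j)) = (\<lambda>j. 2 * ?u j)" by (auto simp: nat_mult_distrib)
    have "multicolourable E (mc ?u + mc ?u) (\<lambda>j. ?u j + ?u j)"
      by (intro multicolourable_add chi)
    then have "mc (\<lambda>j. 2 * ?u j) \<le> 2 * mc ?u" by (simp add: chi_le mult_2)
    moreover have "mc ?u \<le> mc (\<lambda>j. 2 * ?u j) div 2"
      unfolding chi_le by (intro half chi)
    ultimately have "mc (\<lambda>j. 2 * ?u j) = 2 * mc ?u" by linarith
    then show "p (2 * u) = 2 * p u" unfolding p_def eq by simp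
  qed
  define e :: "'n \<Rightarrow> int ^ 'n" where "e j = axis j 1" for j
  define h :: "int ^ 'n" where "h = (\<chi> j. int (of_bool (j \<in> H)))"
  obtain q where q: "doubling_sublinear q" "\<And>v. q v \<le> p v" "q h = p h"
    "\<And>x. x \<in> range e \<Longrightarrow> q (- x) = - q x"
    using doubling_sublinear_minorant[OF \<open>doubling_sublinear p\<close>, of "range e" h] by auto
  have p_h: "p h = int (mc (\<lambda>j. of_bool (j \<in> H)))" by (simp add: p_def h_def)
  have p_stable: "p v \<le> 1" if "stable E S" "\<And>j. v $ j \<le> of_bool (j \<in> S)" for v S
  proof -
    have "multicolourable E (Suc 0) (\<lambda>j. of_bool (j \<in> S) + 0)"
      by (intro multicolourable_Cons that) simp
    then have "multicolourable E (Suc 0) (\<lambda>j. nat (v $ j))"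
      by (rule multicolourable_mono) (use that(2) in \<open>auto simp: nat_le_iff\<close>)
    then show ?thesis by (simp add: p_def flip: chi_le)
  qed
  have q01: "0 \<le> q (e j)" "q (e j) \<le> 1" for j
  proof -
    have "multicolourable E 0 (\<lambda>i. nat ((- e j) $ i))"
      by (auto simp: e_def axis_def fun_eq_iff)
    then have "p (- e j) = 0" unfolding p_def chi_le[symmetric] by simp
    then show "0 \<le> q (e j)" using q(2)[of "- e j"] q(4)[of "e j"] by simp
    have "p (e j) \<le> 1" by (rule p_stable[of "{j}"]) (auto simp: stable_def e_def axis_def)
    then show "q (e j) \<le> 1" using q(2)[of "e j"] by linarith
  qed
  define K where "K = {j. q (e j) = 1}"
  have "clique E K"
    unfolding clique_def
  proof (intro ballI impI, rule ccontr)
    \<comment> \<open>Two nonadjacent vertices form a stable set, so \<open>p\<close> is at most 1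
      at the sum of their unit vectors, whereas linearity gives \<open>q\<close> the value 2
      there.\<close>
    fix i j assume ij: "i \<in> K" "j \<in> K" "i \<noteq> j" "(i, j) \<notin> E"
    then have "(j, i) \<notin> E" using \<open>sym E\<close> by (auto dest: symD)
    then have "p (e i + e j) \<le> 1"
      using ij by (intro p_stable[of "{i, j}"]) (auto simp: stable_def e_def axis_def)
    moreover have "q (e i + e j) = q (e i) + q (e j)"
      using doubling_sublinear_sum[OF q(1), of e "{i, j}" "\<lambda>_. 1"] q(4) ij(3) by auto
    ultimately show False using q(2)[of "e i + e j"] ij(1,2) by (simp add: K_def)
  qed
  have h: "h = (\<Sum>j\<in>UNIV. of_nat (of_bool (j \<in> H)) * e j)"
    by (simp add: vec_eq_iff h_def e_def axis_def of_nat_index if_distrib[of "\<lambda>x. _ * x"] del: of_nat_of_bool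
        cong: if_cong)
  \<comment> \<open>Linearity turns \<open>q h\<close> into the size of the clique
    \<open>K \<inter> H\<close>, while tightness at \<open>h\<close> makes it the least number of
    colours for \<open>H\<close>.\<close>
  have "q h = (\<Sum>j\<in>UNIV. int (of_bool (j \<in> H)) * q (e j))"
    unfolding h by (rule doubling_sublinear_sum[OF q(1)]) (use q(4) in auto)
  also have "\<dots> = (\<Sum>j\<in>UNIV. of_bool (j \<in> K \<inter> H))"
  proof (rule sum.cong[OF refl])
    fix j show "int (of_bool (j \<in> H)) * q (e j) = of_bool (j \<in> K \<inter> H)"
      using q01[of j] by (cases "q (e j) = 1") (auto simp: K_def)
  qed
  also have "\<dots> = int (card (K \<inter> H))" by (simp add: of_bool_def sum.If_cases Int_def)
  finally have card: "card (K \<inter> H) = mc (\<lambda>j. of_bool (j \<in> H))" using q(3) p_h by simp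
  show "chromatic_number H (Restr E H) = clique_number H (Restr E H)"
  proof (rule antisym)
    have "card (K \<inter> H) \<le> clique_number H (Restr E H)"
      using clique_number_le_iff[of H E "clique_number H (Restr E H)"]
        clique_subset[OF \<open>clique E K\<close>, of "K \<inter> H"] by auto
    then show "chromatic_number H (Restr E H) \<le> clique_number H (Restr E H)"
      by (simp add: chromatic_number_le_iff[OF irr] card chi_le)
    have "multicolourable E (chromatic_number H (Restr E H)) (\<lambda>j. of_bool (j \<in> H))"
      using chromatic_number_le_iff[OF irr] by blast
    then show "clique_number H (Restr E H) \<le> chromatic_number H (Restr E H)"
      unfolding clique_number_le_iff
      using multicolourable_clique[of E _ "\<lambda>j. of_bool (j \<in> H)"]
      by (fastforce simp: subset_iff)
  qed
qed

section \<open>Indicator vectors, lattice points and the stable set polytope\<close>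

lemma rho_nth [simp]: "rho W $ j = of_bool (j \<in> W)"
  by (simp add: rho_def axis_def if_distrib[of "\<lambda>x. x $ _"] sum.If_cases of_bool_def cong: if_cong)

lemma integer_points_vec_iff: "(x :: real ^ 'n) \<in> integer_points \<longleftrightarrow> (\<forall>j. x $ j \<in> \<int>)"
  by (auto simp: integer_points_def Basis_vec_def inner_axis)

lemma integer_points_Pair_iff:
  "(x, y) \<in> integer_points \<longleftrightarrow> x \<in> integer_points \<and> y \<in> integer_points"
  by (force simp: integer_points_def Basis_prod_def ball_Un)

lemma integer_points_real_iff: "(t :: real) \<in> integer_points \<longleftrightarrow> t \<in> \<int>"
  by (simp add: integer_points_def)

lemma rho_integer_points: "rho W \<in> integer_points"
  by (simp add: integer_points_vec_iff)

lemma rho_empty [simp]: "rho {} = 0"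
  by (simp add: vec_eq_iff)

lemma rho_stable_set_polytope: "stable E W \<Longrightarrow> rho W \<in> stable_set_polytope E"
  unfolding stable_set_polytope_def by (rule hull_inc) auto

lemma convex_stable_set_polytope: "convex (stable_set_polytope E)"
  by (simp add: stable_set_polytope_def)

lemma zero_stable_set_polytope: "0 \<in> stable_set_polytope E"
  using rho_stable_set_polytope[of E "{}"] by simp

lemma stable_set_polytope_halfspace:
  assumes "x \<in> stable_set_polytope E" "\<And>W. stable E W \<Longrightarrow> c \<bullet> rho W \<le> b"
  shows "c \<bullet> x \<le> b"
proof -
  have "stable_set_polytope E \<subseteq> {x. c \<bullet> x \<le> b}"
    unfolding stable_set_polytope_def
    by (rule hull_minimal) (use assms(2) in \<open>auto simp: convex_halfspace_le\<close>)
  then show ?thesis using assms(1) by blast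
qed

lemma inner_rho: "c \<bullet> rho W = (\<Sum>j\<in>W. c $ j)" "rho W \<bullet> c = (\<Sum>j\<in>W. c $ j)"
  by (simp_all add: inner_vec_def of_bool_def if_distrib[of "\<lambda>x. _ * x"] if_distrib[of "\<lambda>x. x * _"] sum.If_cases cong: if_cong)

lemma inner_rho_rho: "rho V \<bullet> rho W = real (card (V \<inter> W))"
  by (simp add: inner_rho of_bool_def sum.If_cases Int_commute)

lemma stable_set_polytope_nth:
  assumes "x \<in> stable_set_polytope E"
  shows "0 \<le> x $ j" "x $ j \<le> 1"
proof -
  have "- axis j 1 \<bullet> x \<le> 0" "axis j 1 \<bullet> x \<le> 1"
    by (rule stable_set_polytope_halfspace[OF assms]; simp add: inner_axis')+
  then show "0 \<le> x $ j" "x $ j \<le> 1" by (auto simp: inner_axis')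
qed

lemma stable_set_polytope_clique:
  assumes "x \<in> stable_set_polytope E" "clique E K"
  shows "(\<Sum>j\<in>K. x $ j) \<le> 1"
proof -
  have "rho K \<bullet> x \<le> 1"
  proof (rule stable_set_polytope_halfspace[OF assms(1)])
    fix W assume "stable E W"
    then have "card (W \<inter> K) \<le> 1" using card_stable_Int_clique assms(2) by blast
    then show "rho K \<bullet> rho W \<le> 1" by (simp add: inner_rho_rho Int_commute)
  qed
  then show ?thesis by (simp add: inner_rho)
qed

text \<open>Coordinates between 0 and 1 make an integral point an indicator vector, and the clique
  inequality for a single edge makes its support stable.\<close>

lemma stable_set_polytope_integer_points:
  assumes "simple_graph E" "x \<in> stable_set_polytope E" "x \<in> integer_points"
  shows "\<exists>W. stable E W \<and> x = rho W"
proof -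
  define W where "W = {j. x $ j = 1}"
  have nth: "x $ j = 0 \<or> x $ j = 1" for j
  proof -
    obtain m where m: "x $ j = of_int m"
      using assms(3) by (auto simp: integer_points_vec_iff Ints_def)
    then have "m = 0 \<or> m = 1" using stable_set_polytope_nth[OF assms(2), of j] by auto
    then show ?thesis using m by auto
  qed
  have "stable E W"
    unfolding stable_def
  proof (intro ballI impI)
    fix i j assume ij: "i \<in> W" "j \<in> W" "i \<noteq> j"
    show "(i, j) \<notin> E"
    proof
      assume "(i, j) \<in> E"
      then have "clique E {i, j}"
        using assms(1) by (auto simp: clique_def simple_graph_def dest: symD)
      then have "(\<Sum>j\<in>{i, j}. x $ j) \<le> 1" by (rule stable_set_polytope_clique[OF assms(2)])
      then show False using ij by (simp add: W_def)
    qed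
  qed
  moreover have "x = rho W" using nth by (auto simp: vec_eq_iff W_def)
  ultimately show ?thesis by blast
qed

section \<open>The polytope \<open>Omega\<close>, its dilates and its lattice points\<close>

text \<open>By convexity one point from each lifted copy suffices. The last coordinate
  \<open>a - b\<close> together with \<open>a + b = 1\<close> determines the weights.\<close>

lemma mem_Omega_iff:
  fixes P Q :: "(real ^ 'n) set"
  assumes "convex P" "convex Q" "P \<noteq> {}" "Q \<noteq> {}"
  shows "x \<in> Omega P Q \<longleftrightarrow>
    (\<exists>a b p q. 0 \<le> a \<and> 0 \<le> b \<and> a + b = 1 \<and> p \<in> P \<and> q \<in> Q \<and> x = (a *\<^sub>R p - b *\<^sub>R q, a - b))"
proof -
  have eq: "Omega P Q = {u *\<^sub>R s + v *\<^sub>R t |u v s t.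
      u \<ge> 0 \<and> v \<ge> 0 \<and> u + v = 1 \<and> s \<in> P \<times> {1} \<and> t \<in> (uminus ` Q) \<times> {-1}}"
    unfolding Omega_def
    by (rule convex_hull_union_two)
      (use assms in \<open>auto intro!: convex_Times convex_negations\<close>)
  show ?thesis
  proof
    assume "x \<in> Omega P Q"
    then obtain a b s t where *: "x = a *\<^sub>R s + b *\<^sub>R t" "0 \<le> a" "0 \<le> b" "a + b = 1"
      "s \<in> P \<times> {1}" "t \<in> (uminus ` Q) \<times> {-1}"
      unfolding eq mem_Collect_eq by (elim exE conjE) (rule that)
    then obtain p q where "p \<in> P" "q \<in> Q" "s = (p, 1)" "t = (- q, -1)" by fast
    with * show "\<exists>a b p q. 0 \<le> a \<and> 0 \<le> b \<and> a + b = 1 \<and> p \<in> P \<and> q \<in> Q \<and>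
        x = (a *\<^sub>R p - b *\<^sub>R q, a - b)"
      by (intro exI[of _ a] exI[of _ b] exI[of _ p] exI[of _ q]) simp
  next
    assume "\<exists>a b p q. 0 \<le> a \<and> 0 \<le> b \<and> a + b = 1 \<and> p \<in> P \<and> q \<in> Q \<and>
        x = (a *\<^sub>R p - b *\<^sub>R q, a - b)"
    then obtain a b p q where "0 \<le> a" "0 \<le> b" "a + b = 1" "p \<in> P" "q \<in> Q"
      "x = (a *\<^sub>R p - b *\<^sub>R q, a - b)" by (elim exE conjE) (rule that)
    then show "x \<in> Omega P Q"
      unfolding eq mem_Collect_eq
      by (intro exI[of _ a] exI[of _ b] exI[of _ "(p, 1)"] exI[of _ "(- q, -1)"]) simp
  qed
qed

lemma mem_Omega_stable:
  "x \<in> Omega (stable_set_polytope E1) (stable_set_polytope E2) \<longleftrightarrow>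
    (\<exists>a b p q. 0 \<le> a \<and> 0 \<le> b \<and> a + b = 1 \<and>
      p \<in> stable_set_polytope E1 \<and> q \<in> stable_set_polytope E2 \<and>
      x = (a *\<^sub>R p - b *\<^sub>R q, a - b))"
  by (rule mem_Omega_iff) (use zero_stable_set_polytope in \<open>auto simp: convex_stable_set_polytope\<close>)

lemma mem_dilated_Omega:
  fixes n :: nat
  assumes "n \<ge> 1"
  shows "x \<in> (\<lambda>x. real n *\<^sub>R x) ` Omega (stable_set_polytope E1) (stable_set_polytope E2) \<longleftrightarrow>
    (\<exists>a b p q. 0 \<le> a \<and> 0 \<le> b \<and> a + b = real n \<and>
      p \<in> stable_set_polytope E1 \<and> q \<in> stable_set_polytope E2 \<and>
      x = (a *\<^sub>R p - b *\<^sub>R q, a - b))" (is "?l \<longleftrightarrow> ?r")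
proof
  assume ?l
  then obtain a b p q where *: "0 \<le> a" "0 \<le> b" "a + b = 1"
    "p \<in> stable_set_polytope E1" "q \<in> stable_set_polytope E2"
    "x = real n *\<^sub>R (a *\<^sub>R p - b *\<^sub>R q, a - b)"
    unfolding image_iff Bex_def mem_Omega_stable by blast
  have "real n * a + real n * b = real n" using *(3) by (metis distrib_left mult.right_neutral)
  moreover have "x = ((real n * a) *\<^sub>R p - (real n * b) *\<^sub>R q, real n * a - real n * b)"
    unfolding *(6) by (simp add: scaleR_diff_right right_diff_distrib)
  ultimately show ?r using *(1,2,4,5)
    by (intro exI[of _ "real n * a"] exI[of _ "real n * b"] exI[of _ p] exI[of _ q]) simp
next
  assume ?r
  then obtain a b p q where *: "0 \<le> a" "0 \<le> b" "a + b = real n"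
    "p \<in> stable_set_polytope E1" "q \<in> stable_set_polytope E2"
    "x = (a *\<^sub>R p - b *\<^sub>R q, a - b)"
    by auto
  let ?y = "((a / n) *\<^sub>R p - (b / n) *\<^sub>R q, a / n - b / n)"
  have "?y \<in> Omega (stable_set_polytope E1) (stable_set_polytope E2)"
    unfolding mem_Omega_stable
    by (intro exI[of _ "a / n"] exI[of _ "b / n"] exI[of _ p] exI[of _ q])
      (use *(1-5) assms in \<open>simp flip: add_divide_distrib\<close>)
  moreover have "x = real n *\<^sub>R ?y"
    unfolding *(6) using assms by (simp add: scaleR_diff_right right_diff_distrib)
  ultimately show ?l by blast
qed

text \<open>The last coordinate is -1, 0 or 1. At 0 both weights are 1/2, so all coordinates have
  absolute value at most 1/2 and vanish; at 1 the point comes from the first polytope alone. Height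
  -1 is left without detail, since the later argument excludes it.\<close>

lemma Omega_integer_points_cases:
  assumes "simple_graph E1"
    and x: "(x, t) \<in> Omega (stable_set_polytope E1) (stable_set_polytope E2)"
    and int: "(x, t) \<in> integer_points"
  shows "t = -1 \<or> t = 0 \<and> x = 0 \<or> t = 1 \<and> (\<exists>W. stable E1 W \<and> x = rho W)"
proof -
  obtain a b p q where *: "0 \<le> a" "0 \<le> b" "a + b = 1"
    "p \<in> stable_set_polytope E1" "q \<in> stable_set_polytope E2"
    "x = a *\<^sub>R p - b *\<^sub>R q" "t = a - b"
    using x by (auto simp: mem_Omega_stable)
  obtain m where m: "t = of_int m"
    using int by (auto simp: integer_points_Pair_iff integer_points_real_iff Ints_def)
  have "-1 \<le> t" "t \<le> 1" using * by auto
  then consider "m = -1" | "m = 0" | "m = 1" using m by (cases "m < 0"; cases "m > 0") force+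
  then show ?thesis
  proof cases
    case 1
    then show ?thesis using m by simp
  next
    case 2
    then have ab: "a = 1/2" "b = 1/2" using * m by auto
    have "x $ j = 0" for j
    proof -
      obtain k where k: "x $ j = of_int k"
        using int by (auto simp: integer_points_Pair_iff integer_points_vec_iff Ints_def)
      have "\<bar>x $ j\<bar> \<le> 1/2"
        using stable_set_polytope_nth[OF *(4), of j] stable_set_polytope_nth[OF *(5), of j]
        unfolding *(6) ab by (simp add: abs_le_iff field_simps)
      then have "k = 0" unfolding k by linarith
      then show ?thesis using k by simp
    qed
    then show ?thesis using 2 m by (simp add: vec_eq_iff)
  next
    case 3
    then have "a = 1" "b = 0" using * m by linarith+
    then have "x = p" using * by simp
    then show ?thesis
      using stable_set_polytope_integer_points[OF assms(1) *(4)] int 3 m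
      by (auto simp: integer_points_Pair_iff)
  qed
qed

section \<open>Integer decomposition implies perfection\<close>

lemma integer_decomposition_property_list_iff:
  fixes P :: "'a::euclidean_space set"
  shows "integer_decomposition_property P \<longleftrightarrow>
    (\<forall>n\<ge>1. \<forall>a \<in> (\<lambda>x. real n *\<^sub>R x) ` P \<inter> integer_points.
      \<exists>xs. length xs = n \<and> set xs \<subseteq> P \<inter> integer_points \<and> a = sum_list xs)"
proof -
  have "(\<exists>f :: nat \<Rightarrow> 'a. (\<forall>i\<in>{1..n}. f i \<in> P \<inter> integer_points) \<and> a = (\<Sum>i=1..n. f i)) \<longleftrightarrow>
    (\<exists>xs. length xs = n \<and> set xs \<subseteq> P \<inter> integer_points \<and> a = sum_list xs)" (is "?l \<longleftrightarrow> ?r") for n a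
  proof
    assume ?l
    then obtain f where f: "\<forall>i\<in>{1..n}. f i \<in> P \<inter> integer_points" "a = (\<Sum>i=1..n. f i)" by blast
    have "a = sum_list (map f [1..<Suc n])"
      using f(2) by (simp only: interv_sum_list_conv_sum_set_nat set_upt atLeastLessThanSuc_atLeastAtMost)
    then show ?r using f(1) by (intro exI[of _ "map f [1..<Suc n]"]) auto
  next
    assume ?r
    then obtain xs where xs: "length xs = n" "set xs \<subseteq> P \<inter> integer_points" "a = sum_list xs" by blast
    have "(\<Sum>i=1..n. xs ! (i - 1)) = (\<Sum>i=0..<n. xs ! i)"
      by (rule sum.reindex_bij_witness[of _ Suc "\<lambda>i. i - 1"]) auto
    then have "a = (\<Sum>i=1..n. xs ! (i - 1))" using xs(1,3) by (simp add: sum_list_sum_nth)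
    moreover have "xs ! (i - 1) \<in> P \<inter> integer_points" if "i \<in> {1..n}" for i
      using that xs(1,2) nth_mem[of "i - 1" xs] by auto
    ultimately show ?l by (intro exI[of _ "\<lambda>i. xs ! (i - 1)"] conjI ballI)
  qed
  then show ?thesis unfolding integer_decomposition_property_def by simp
qed

definition real_vec :: "('n::finite \<Rightarrow> nat) \<Rightarrow> real ^ 'n" where
  "real_vec w = (\<chi> j. real (w j))"

lemma real_vec_multiplicity_in: "real_vec (multiplicity_in Ss) = (\<Sum>S\<leftarrow>Ss. rho S)"
proof (induction Ss)
  case Nil
  then show ?case by (simp add: real_vec_def vec_eq_iff)
next
  case (Cons S Ss)
  then show ?case by (simp add: real_vec_def vec_eq_iff flip: Cons.IH)
qed

text \<open>\<open>p\<close> is the mean of the indicator vectors, built as a running average; for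
  \<open>k = 0\<close> the origin serves.\<close>

lemma multicolourable_in_dilation:
  assumes "multicolourable E k w"
  shows "\<exists>p\<in>stable_set_polytope E. real_vec w = real k *\<^sub>R p"
proof -
  obtain Ss where Ss: "length Ss = k" "\<forall>S\<in>set Ss. stable E S" "w = multiplicity_in Ss"
    using assms by (auto simp: multicolourable_def)
  have "\<exists>p\<in>stable_set_polytope E. (\<Sum>S\<leftarrow>Ss. rho S) = real (length Ss) *\<^sub>R p"
    using Ss(2)
  proof (induction Ss)
    case Nil
    then show ?case using zero_stable_set_polytope by auto
  next
    case (Cons S Ss)
    then obtain p where p: "p \<in> stable_set_polytope E" "(\<Sum>S\<leftarrow>Ss. rho S) = real (length Ss) *\<^sub>R p"
      by auto
    define n where "n = real (length Ss)"
    have n: "n \<ge> 0" by (simp add: n_def)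
    define q where "q = (1 / (n + 1)) *\<^sub>R rho S + (n / (n + 1)) *\<^sub>R p"
    have "q \<in> stable_set_polytope E"
      unfolding q_def
      by (rule convexD[OF convex_stable_set_polytope rho_stable_set_polytope p(1)])
        (use n Cons.prems in \<open>auto simp flip: add_divide_distrib\<close>)
    moreover have "(n + 1) *\<^sub>R q = rho S + n *\<^sub>R p"
      using n by (simp add: q_def scaleR_add_right)
    moreover have "(\<Sum>S\<leftarrow>S # Ss. rho S) = (n + 1) *\<^sub>R q"
      using calculation(2) p(2) by (simp add: n_def)
    moreover have "n + 1 = real (length (S # Ss))" by (simp add: n_def)
    ultimately show ?case by metis
  qed
  then show ?thesis using Ss real_vec_multiplicity_in by metis
qed

lemma integer_decomposition_imp_halving:
  assumes "simple_graph E1"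
    and idp: "integer_decomposition_property (Omega (stable_set_polytope E1) (stable_set_polytope E2))"
    and m: "multicolourable E1 m (\<lambda>j. 2 * w j)"
  shows "multicolourable E1 (m div 2) w"
proof (cases "m = 0")
  case True
  then show ?thesis using m by (simp add: fun_eq_iff)
next
  case False
  define P where "P = Omega (stable_set_polytope E1) (stable_set_polytope E2)"
  \<comment> \<open>\<open>h\<close> and \<open>n\<close> are the lower and upper halves of
    \<open>m\<close>, so \<open>n - h\<close> is 0 or 1.\<close>
  define h where "h = m div 2"
  define n where "n = m - h"
  have n: "n \<ge> 1" "m = n + h" "h \<le> n" "n \<le> Suc h"
    using False unfolding n_def h_def by linarith+
  then have half: "real m = real n + real h" "2 * real h \<le> real m"
    by linarith+
  obtain p where p: "p \<in> stable_set_polytope E1" "real_vec (\<lambda>j. 2 * w j) = real m *\<^sub>R p"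
    using multicolourable_in_dilation[OF m] by blast
  have w: "real_vec w = (real m / 2) *\<^sub>R p"
    using p(2) by (simp add: real_vec_def vec_eq_iff field_simps)
  \<comment> \<open>Weight \<open>m / 2\<close> goes to \<open>p\<close>; the remaining weight, 0 or
    1/2, goes to the origin as a point of the second polytope.\<close>
  have "(real_vec w, real h) \<in> (\<lambda>x. real n *\<^sub>R x) ` P"
    unfolding P_def mem_dilated_Omega[OF n(1)]
  proof (intro exI conjI)
    show "real m / 2 + (real m / 2 - real h) = real n"
      "0 \<le> real m / 2 - real h" using half by (simp_all add: field_simps)
    show "(real_vec w, real h) =
        ((real m / 2) *\<^sub>R p - (real m / 2 - real h) *\<^sub>R 0,
         real m / 2 - (real m / 2 - real h))"
      by (simp add: w)
    show "0 \<le> real m / 2" by simp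
  qed (rule p(1) zero_stable_set_polytope)+
  moreover have "(real_vec w, real h) \<in> integer_points"
    by (simp add: integer_points_Pair_iff integer_points_vec_iff integer_points_real_iff real_vec_def)
  ultimately have "\<exists>xs. length xs = n \<and> set xs \<subseteq> P \<inter> integer_points \<and>
      (real_vec w, real h) = sum_list xs"
    by (intro idp[folded P_def, unfolded integer_decomposition_property_list_iff, rule_format, OF n(1)] IntI)
  then obtain xs where xs: "length xs = n" "set xs \<subseteq> P \<inter> integer_points"
    "(real_vec w, real h) = sum_list xs" by blast
  have cases: "snd x = -1 \<or> x = 0 \<or> snd x = 1 \<and> (\<exists>W. stable E1 W \<and> fst x = rho W)" if "x \<in> set xs" for x
  proof -
    have "(fst x, snd x) \<in> P" "(fst x, snd x) \<in> integer_points"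
      unfolding prod.collapse using that xs(2) by blast+
    then have "snd x = -1 \<or> snd x = 0 \<and> fst x = 0 \<or> snd x = 1 \<and> (\<exists>W. stable E1 W \<and> fst x = rho W)"
      unfolding P_def by (rule Omega_integer_points_cases[OF assms(1)])
    then show ?thesis by (auto simp: prod_eq_iff)
  qed
  have snd_le: "snd (sum_list ys) \<le> real (length ys)" if "set ys \<subseteq> set xs" for ys
    using that
  proof (induction ys)
    case (Cons y ys)
    then show ?case using cases[of y] by auto
  qed simp
  \<comment> \<open>A summand at height -1 would leave a total height of at most
    \<open>n - 2\<close>, but \<open>h\<close> is at least \<open>n - 1\<close>.\<close>
  have no: "snd x \<noteq> -1" if elem: "x \<in> set xs" for x
  proof
    assume x: "snd x = -1"
    obtain ys zs where "xs = ys @ x # zs" using elem by (meson split_list)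
    moreover from this have "snd (sum_list ys) \<le> real (length ys)" "snd (sum_list zs) \<le> real (length zs)"
      by (intro snd_le; auto)+
    ultimately have "snd (sum_list xs) \<le> real (length xs) - 2" using x by simp
    moreover have "snd (sum_list xs) = real h" using xs(3) by (metis snd_conv)
    ultimately show False using xs(1) n(4) by linarith
  qed
  \<comment> \<open>Every summand is now the origin or a lifted stable set, and the last coordinate
    counts the latter, so exactly \<open>h\<close> stable sets are found.\<close>
  have "\<exists>Ss. (\<forall>S\<in>set Ss. stable E1 S) \<and> sum_list ys = ((\<Sum>S\<leftarrow>Ss. rho S), real (length Ss))"
    if "set ys \<subseteq> set xs" for ys
    using that
  proof (induction ys)
    case Nil
    then show ?case by (intro exI[of _ "[]"]) (simp add: zero_prod_def)
  next
    case (Cons y ys)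
    then obtain Ss where Ss: "\<forall>S\<in>set Ss. stable E1 S"
      "sum_list ys = ((\<Sum>S\<leftarrow>Ss. rho S), real (length Ss))" by auto
    consider "y = 0" | W where "stable E1 W" "y = (rho W, 1)"
      using cases[of y] no[of y] Cons.prems by (auto simp: prod_eq_iff)
    then show ?case
    proof cases
      case 1
      then show ?thesis using Ss by auto
    next
      case 2
      then show ?thesis using Ss by (intro exI[of _ "W # Ss"]) auto
    qed
  qed
  then obtain Ss where Ss: "\<forall>S\<in>set Ss. stable E1 S"
    "sum_list xs = ((\<Sum>S\<leftarrow>Ss. rho S), real (length Ss))" by blast
  then have "real_vec w = real_vec (multiplicity_in Ss)" "length Ss = h"
    using xs(3) by (auto simp: real_vec_multiplicity_in)
  then show ?thesis
    using Ss(1) unfolding multicolourable_def h_def[symmetric] real_vec_def vec_eq_iff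
    by (intro exI[of _ Ss]) auto
qed

text \<open>Negating a convex combination swaps its weights; this is what transfers results from one
  graph to the other.\<close>

lemma uminus_mem_Omega_stable:
  "- x \<in> Omega (stable_set_polytope E2) (stable_set_polytope E1) \<longleftrightarrow>
    x \<in> Omega (stable_set_polytope E1) (stable_set_polytope E2)"
proof -
  have "- x \<in> Omega (stable_set_polytope E2) (stable_set_polytope E1)"
    if x: "x \<in> Omega (stable_set_polytope E1) (stable_set_polytope E2)" for x and E1 E2 :: "('a \<times> 'a) set"
  proof -
    obtain a b p q where *: "0 \<le> a" "0 \<le> b" "a + b = 1"
      "p \<in> stable_set_polytope E1" "q \<in> stable_set_polytope E2" "x = (a *\<^sub>R p - b *\<^sub>R q, a - b)"
      using x unfolding mem_Omega_stable by (elim exE conjE) (rule that)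
    then show ?thesis
      unfolding mem_Omega_stable
      by (intro exI[of _ b] exI[of _ a] exI[of _ q] exI[of _ p]) simp
  qed
  from this[of x E1 E2] this[of "- x" E2 E1] show ?thesis by auto
qed

lemma integer_points_uminus: "- x \<in> integer_points \<longleftrightarrow> x \<in> integer_points"
  by (simp add: integer_points_def)

lemma integer_decomposition_property_Omega_swap:
  assumes "integer_decomposition_property (Omega (stable_set_polytope E1) (stable_set_polytope E2))"
  shows "integer_decomposition_property (Omega (stable_set_polytope E2) (stable_set_polytope E1))"
  unfolding integer_decomposition_property_list_iff
proof (intro allI impI ballI)
  let ?P = "Omega (stable_set_polytope E1) (stable_set_polytope E2)"
  let ?Q = "Omega (stable_set_polytope E2) (stable_set_polytope E1)"
  fix n :: nat and a
  assume n: "1 \<le> n" and a: "a \<in> (\<lambda>x. real n *\<^sub>R x) ` ?Q \<inter> integer_points"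
  then obtain x where x: "x \<in> ?Q" "a = real n *\<^sub>R x" by blast
  have "- a = real n *\<^sub>R (- x)" "- x \<in> ?P" using x uminus_mem_Omega_stable[of x] by auto
  then have "- a \<in> (\<lambda>x. real n *\<^sub>R x) ` ?P \<inter> integer_points"
    using a integer_points_uminus[of a] by blast
  then obtain xs where xs: "length xs = n" "set xs \<subseteq> ?P \<inter> integer_points" "- a = sum_list xs"
    using assms n unfolding integer_decomposition_property_list_iff by blast
  have "a = sum_list (map uminus xs)"
    using uminus_sum_list_map[of id xs] unfolding list.map_id comp_id xs(3)[symmetric] by simp
  moreover have "set (map uminus xs) \<subseteq> ?Q \<inter> integer_points"
  proof
    fix v assume "v \<in> set (map uminus xs)"
    then obtain u where "v = - u" "u \<in> ?P" "u \<in> integer_points"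
      using xs(2) unfolding set_map by blast
    then show "v \<in> ?Q \<inter> integer_points"
      using uminus_mem_Omega_stable integer_points_uminus by blast
  qed
  ultimately show "\<exists>xs. length xs = n \<and> set xs \<subseteq> ?Q \<inter> integer_points \<and> a = sum_list xs"
    using xs(1) by (intro exI[of _ "map uminus xs"]) auto
qed

lemma perfect_if_integer_decomposition:
  assumes "simple_graph E1"
    "integer_decomposition_property (Omega (stable_set_polytope E1) (stable_set_polytope E2))"
  shows "perfect E1"
  by (rule perfect_if_multicolourable_halving[OF assms(1) integer_decomposition_imp_halving[OF assms]])

section \<open>Perfection implies integer decomposition\<close>

text \<open>The clique inequalities bound every clique weight by \<open>a\<close>, and integrality
  lowers the bound to its floor. Domination by \<open>a * p $ j\<close>, rather than equality,
  allows \<open>w\<close> to be a positive or negative part.\<close>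

lemma perfect_dilation_multicolourable:
  assumes "simple_graph E" "perfect E" "p \<in> stable_set_polytope E" "0 \<le> a"
    and le: "\<And>j. real (w j) \<le> a * p $ j"
  shows "multicolourable E (nat \<lfloor>a\<rfloor>) w"
proof (rule perfect_imp_multicolourable)
  fix K assume "clique E K"
  have "real (sum w K) \<le> (\<Sum>j\<in>K. a * p $ j)" unfolding of_nat_sum by (intro sum_mono le)
  also have "\<dots> = a * (\<Sum>j\<in>K. p $ j)" by (simp add: sum_distrib_left)
  also have "\<dots> \<le> a"
    using mult_left_mono[OF stable_set_polytope_clique[OF assms(3) \<open>clique E K\<close>] assms(4)] by simp
  finally show "sum w K \<le> nat \<lfloor>a\<rfloor>" using le_nat_floor by blast
qed (use assms(1,2) in \<open>auto simp: simple_graph_def\<close>)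

lemma rho_mem_Omega: "stable E1 W \<Longrightarrow> (rho W, 1) \<in> Omega (stable_set_polytope E1) (stable_set_polytope E2)"
  and minus_rho_mem_Omega:
    "stable E2 W \<Longrightarrow> (- rho W, -1) \<in> Omega (stable_set_polytope E1) (stable_set_polytope E2)"
  and zero_mem_Omega: "0 \<in> Omega (stable_set_polytope E1) (stable_set_polytope E2)"
proof -
  show one: "(rho W, 1) \<in> Omega (stable_set_polytope E1) (stable_set_polytope E2)"
    if "stable E1 W" for E1 E2 :: "('a \<times> 'a) set" and W
    unfolding mem_Omega_stable
    by (intro exI[of _ 1] exI[of _ 0] exI[of _ "rho W"])
      (simp add: rho_stable_set_polytope[OF that] zero_stable_set_polytope)
  show "(- rho W, -1) \<in> Omega (stable_set_polytope E1) (stable_set_polytope E2)" if "stable E2 W"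
    using uminus_mem_Omega_stable[of "(rho W, 1)" E1 E2] one[OF that, of E1] by simp
  show "0 \<in> Omega (stable_set_polytope E1) (stable_set_polytope E2)"
    unfolding mem_Omega_stable
    by (intro exI[of _ "1/2"] exI[of _ 0])
      (simp add: zero_stable_set_polytope zero_prod_def)
qed

lemma perfect_imp_integer_decomposition:
  fixes E1 E2 :: "('n::finite \<times> 'n) set"
  assumes G1: "simple_graph E1" "perfect E1" and G2: "simple_graph E2" "perfect E2"
  shows "integer_decomposition_property (Omega (stable_set_polytope E1) (stable_set_polytope E2))"
  unfolding integer_decomposition_property_list_iff
proof (intro allI impI ballI)
  let ?P = "Omega (stable_set_polytope E1) (stable_set_polytope E2)"
  fix n :: nat and y
  assume n: "1 \<le> n" and y: "y \<in> (\<lambda>x. real n *\<^sub>R x) ` ?P \<inter> integer_points"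
  have "y \<in> (\<lambda>x. real n *\<^sub>R x) ` ?P" using y by blast
  then obtain a b p q where *: "0 \<le> a" "0 \<le> b" "a + b = real n"
    "p \<in> stable_set_polytope E1" "q \<in> stable_set_polytope E2" "y = (a *\<^sub>R p - b *\<^sub>R q, a - b)"
    unfolding mem_dilated_Omega[OF n] by (elim exE conjE) (rule that)
  have "y \<in> integer_points" using y by blast
  then have int: "a * p $ j - b * q $ j \<in> \<int>" "a - b \<in> \<int>" for j
    unfolding *(6) by (auto simp: integer_points_Pair_iff integer_points_vec_iff integer_points_real_iff)
  \<comment> \<open>The positive and negative parts of the first component. As
    \<open>a * p $ j\<close> and \<open>b * q $ j\<close> are nonnegative, they dominate the
    respective parts of their difference.\<close>
  define u l where "u j = nat \<lfloor>a * p $ j - b * q $ j\<rfloor>" and "l j = nat \<lfloor>b * q $ j - a * p $ j\<rfloor>" for j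
  have ul: "real (u j) - real (l j) = a * p $ j - b * q $ j \<and>
      real (u j) \<le> a * p $ j \<and> real (l j) \<le> b * q $ j" for j
  proof -
    obtain k where k: "a * p $ j - b * q $ j = of_int k" using int(1)[of j] by (auto simp: Ints_def)
    then have k': "b * q $ j - a * p $ j = of_int (- k)" by simp
    have "0 \<le> a * p $ j" "0 \<le> b * q $ j"
      using * stable_set_polytope_nth by (meson mult_nonneg_nonneg)+
    moreover have "u j = nat k" "l j = nat (- k)" unfolding u_def l_def k k' floor_of_int by simp_all
    ultimately show ?thesis using k by (cases "k \<ge> 0") simp_all
  qed
  obtain Ss where Ss: "length Ss = nat \<lfloor>a\<rfloor>" "\<forall>S\<in>set Ss. stable E1 S" "u = multiplicity_in Ss"
    using perfect_dilation_multicolourable[OF G1 *(4,1), of u] ul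
    by (auto simp: multicolourable_def)
  obtain Ts where Ts: "length Ts = nat \<lfloor>b\<rfloor>" "\<forall>S\<in>set Ts. stable E2 S" "l = multiplicity_in Ts"
    using perfect_dilation_multicolourable[OF G2 *(5,2), of l] ul
    by (auto simp: multicolourable_def)
  \<comment> \<open>Since \<open>a - b\<close> is an integer, rounding both weights down preserves
    their difference, so the last coordinate comes out right.\<close>
  obtain t where t: "a - b = of_int t" using int(2) by (auto simp: Ints_def)
  then have "a = b + of_int t" by simp
  then have fl: "\<lfloor>a\<rfloor> = \<lfloor>b\<rfloor> + t" by simp
  have len: "length Ss + length Ts \<le> n" "a - b = real (length Ss) - real (length Ts)"
    using *(1-3) t fl unfolding Ss(1) Ts(1) by linarith+
  \<comment> \<open>Copies of the origin fill the places lost by rounding \<open>a\<close> and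
    \<open>b\<close> down.\<close>
  define xs where "xs = map (\<lambda>S. (rho S, 1::real)) Ss @ map (\<lambda>S. (- rho S, -1)) Ts @
    replicate (n - (length Ss + length Ts)) 0"
  have zeros: "sum_list (replicate k 0) = (0 :: (real ^ 'n) \<times> real)" for k
    by (induction k) simp_all
  have sum: "sum_list (map (\<lambda>S. (rho S, 1::real)) Ws) = (\<Sum>S\<leftarrow>Ws. rho S, real (length Ws))"
    for Ws :: "'n set list"
  proof (induction Ws)
    case Nil
    show ?case by (simp add: zero_prod_def)
  qed simp
  have "sum_list (map (\<lambda>S. (- rho S, -1::real)) Ts) = - sum_list (map (\<lambda>S. (rho S, 1::real)) Ts)"
    by (induction Ts) simp_all
  then have "sum_list xs = (real_vec u - real_vec l, a - b)"
    unfolding xs_def Ss(3) Ts(3) real_vec_multiplicity_in len(2) by (simp add: sum zeros)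
  also have "real_vec u - real_vec l = a *\<^sub>R p - b *\<^sub>R q"
    using ul by (simp add: real_vec_def vec_eq_iff)
  finally have "y = sum_list xs" using *(6) by simp
  moreover have "set xs \<subseteq> ?P \<inter> integer_points"
    using Ss(2) Ts(2)
    by (auto simp: xs_def rho_mem_Omega minus_rho_mem_Omega zero_mem_Omega rho_integer_points
        integer_points_Pair_iff integer_points_uminus integer_points_real_iff)
      (auto simp: integer_points_def)
  moreover have "length xs = n" using len(1) by (simp add: xs_def)
  ultimately show "\<exists>xs. length xs = n \<and> set xs \<subseteq> ?P \<inter> integer_points \<and> y = sum_list xs" by blast
qed

section \<open>Reflexivity: interior point and dual polytope\<close>

lemma lattice_polytope_Omega:
  fixes E1 E2 :: "('n::finite \<times> 'n) set"
  shows "lattice_polytope (Omega (stable_set_polytope E1) (stable_set_polytope E2))"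
proof -
  define A where "A = rho ` {W. stable E1 W} \<times> {1::real}"
  define B where "B = uminus ` rho ` {W. stable E2 W} \<times> {-1::real}"
  have "convex hull A = stable_set_polytope E1 \<times> {1}"
    by (simp add: A_def convex_hull_Times stable_set_polytope_def)
  moreover have "convex hull B = uminus ` stable_set_polytope E2 \<times> {-1}"
    by (simp add: B_def convex_hull_Times stable_set_polytope_def convex_hull_linear_image[OF linear_uminus])
  ultimately have "Omega (stable_set_polytope E1) (stable_set_polytope E2) = convex hull (A \<union> B)"
    unfolding Omega_def by (metis hull_Un_left hull_Un_right)
  moreover have "finite (A \<union> B)" by (simp add: A_def B_def)
  moreover have "A \<union> B \<subseteq> integer_points"
    by (auto simp: A_def B_def integer_points_Pair_iff integer_points_uminus rho_integer_points
        integer_points_real_iff)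
  ultimately show ?thesis by (auto simp: lattice_polytope_def)
qed

text \<open>Otherwise some nonzero linear functional would be nonnegative on the polytope. The
  lifted empty sets at heights 1 and -1 kill its last coefficient, and then the lifted singletons
  kill the others.\<close>

lemma zero_interior_Omega:
  fixes E1 E2 :: "('n::finite \<times> 'n) set"
  shows "0 \<in> interior (Omega (stable_set_polytope E1) (stable_set_polytope E2))"
proof -
  define P where "P = Omega (stable_set_polytope E1) (stable_set_polytope E2)"
  have "convex P" by (simp add: P_def Omega_def)
  have no_hyperplane: "c = 0" if c: "\<And>x. x \<in> P \<Longrightarrow> 0 \<le> c \<bullet> x" for c
  proof -
    obtain v s where vs: "c = (v, s)" by (cases c)
    have 1: "0 \<le> (\<Sum>j\<in>W. v $ j) + s" "0 \<le> - (\<Sum>j\<in>V. v $ j) - s"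
      if "stable E1 W" "stable E2 V" for V W
      using c[OF rho_mem_Omega[OF that(1), of E2, folded P_def]]
        c[OF minus_rho_mem_Omega[OF that(2), of E1, folded P_def]]
      by (simp_all add: vs inner_rho)
    have "s = 0" using 1[of "{}" "{}"] by simp
    moreover have "v $ j = 0" for j
      using 1[of "{j}" "{j}"] \<open>s = 0\<close> by (simp add: stable_def)
    ultimately show ?thesis by (simp add: vs vec_eq_iff zero_prod_def)
  qed
  have "0 \<in> interior P"
  proof (cases "interior P = {}")
    case True
    then obtain c b where c: "c \<noteq> 0" "P \<subseteq> {x. c \<bullet> x = b}"
      using empty_interior_subset_hyperplane[OF \<open>convex P\<close>] by metis
    moreover have "0 \<in> P" by (simp add: P_def zero_mem_Omega)
    ultimately have "b = 0" by auto
    then have "c = 0" using c(2) by (intro no_hyperplane) auto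
    then show ?thesis using c(1) by simp
  next
    case False
    show ?thesis
    proof (rule ccontr)
      assume "0 \<notin> interior P"
      then obtain c where c: "c \<noteq> 0" "\<forall>x\<in>interior P. 0 \<le> c \<bullet> x"
        using separating_hyperplane_set_0[OF convex_interior[OF \<open>convex P\<close>]] by blast
      \<comment> \<open>The separation concerns the interior only; taking closures extends it to all
        of \<open>P\<close>.\<close>
      have "closure (interior P) \<subseteq> {x. 0 \<le> c \<bullet> x}"
        using c(2) by (intro closure_minimal) (auto simp: closed_halfspace_ge[of 0, simplified])
      then have "P \<subseteq> {x. 0 \<le> c \<bullet> x}"
        using convex_closure_interior[OF \<open>convex P\<close> False] closure_subset by blast
      then have "c = 0" by (intro no_hyperplane) auto
      then show False using c(1) by simp
    qed
  qed
  then show ?thesis by (simp add: P_def)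
qed

text \<open>
  A vector \<open>z\<close> outside the convex hull is separated from it by a direction \<open>c\<close>. Rounding a large
  multiple of the positive part of \<open>c\<close> down gives integer weights, whose multicolouring
  contradicts the bound on \<open>z\<close>.
\<close>

lemma perfect_antiblocker:
  fixes E :: "('n::finite \<times> 'n) set"
  assumes E: "simple_graph E" "perfect E"
    and z: "\<And>j. 0 \<le> z $ j" "\<And>W. stable E W \<Longrightarrow> (\<Sum>j\<in>W. z $ j) \<le> 1"
  shows "z \<in> convex hull (rho ` {K. clique E K})"
proof (rule ccontr)
  let ?C = "convex hull (rho ` {K. clique E K})"
  assume "z \<notin> ?C"
  moreover have "closed ?C" by (intro compact_imp_closed compact_convex_hull finite_imp_compact) simp
  ultimately obtain c' b' where c': "c' \<bullet> z < b'" "\<forall>x\<in>?C. c' \<bullet> x > b'"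
    using separating_hyperplane_closed_point[OF convex_convex_hull] by blast
  define c b where "c = - c'" and "b = - b'"
  have c: "b < c \<bullet> z" "(\<Sum>j\<in>K. c $ j) < b" if "clique E K" for K
  proof -
    show "b < c \<bullet> z" using c'(1) by (simp add: c_def b_def)
    have "rho K \<in> ?C" using that by (intro hull_inc) auto
    then show "(\<Sum>j\<in>K. c $ j) < b" using c'(2) by (auto simp: c_def b_def inner_rho sum_negf)
  qed
  have bz: "b < c \<bullet> z" using c(1)[of "{}"] by (simp add: clique_def)
  have "b > 0" using c(2)[of "{}"] by (simp add: clique_def)
  define d where "d j = max 0 (c $ j)" for j
  have d0: "d j \<ge> 0" for j by (simp add: d_def)
  have d_clique: "sum d K \<le> b" if "clique E K" for K
  proof -
    \<comment> \<open>Dropping the nonpositive coordinates leaves a smaller clique, so the bound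
      \<open>b\<close> persists.\<close>
    have "sum d K = (\<Sum>j\<in>K \<inter> {j. c $ j > 0}. c $ j)"
      by (rule sum.mono_neutral_cong_right) (auto simp: d_def)
    then show ?thesis using c(2)[OF clique_subset[OF that, of "K \<inter> {j. c $ j > 0}"]] by simp
  qed
  have "c \<bullet> z \<le> (\<Sum>j\<in>UNIV. d j * z $ j)"
    unfolding inner_vec_def by (intro sum_mono) (auto simp: d_def intro: mult_right_mono z)
  then have gap: "0 < (\<Sum>j\<in>UNIV. d j * z $ j) - b" using bz by simp
  \<comment> \<open>Rounding \<open>real M * d j\<close> down costs at most 1 per vertex, hence at
    most the sum of \<open>z\<close> in total, independently of \<open>M\<close>. A positive gap
    would make the left side unbounded.\<close>
  have "real M * ((\<Sum>j\<in>UNIV. d j * z $ j) - b) \<le> (\<Sum>j\<in>UNIV. z $ j)" for M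
  proof -
    define w where "w j = nat \<lfloor>real M * d j\<rfloor>" for j
    have w: "real (w j) \<le> real M * d j" "real M * d j - 1 \<le> real (w j)" for j
      using d0[of j] by (auto simp: w_def)
    have "multicolourable E (nat \<lfloor>real M * b\<rfloor>) w"
    proof (rule perfect_imp_multicolourable)
      fix K assume "clique E K"
      have "real (sum w K) \<le> (\<Sum>j\<in>K. real M * d j)" unfolding of_nat_sum by (intro sum_mono w)
      also have "\<dots> \<le> real M * b"
        using d_clique[OF \<open>clique E K\<close>] by (simp add: mult_left_mono flip: sum_distrib_left)
      finally show "sum w K \<le> nat \<lfloor>real M * b\<rfloor>" using le_nat_floor by blast
    qed (use E in \<open>auto simp: simple_graph_def\<close>)
    then obtain p where p: "p \<in> stable_set_polytope E"
      "real_vec w = real (nat \<lfloor>real M * b\<rfloor>) *\<^sub>R p"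
      using multicolourable_in_dilation by blast
    have "z \<bullet> p \<le> 1" using p(1) by (rule stable_set_polytope_halfspace) (simp add: inner_rho z(2))
    then have "z \<bullet> real_vec w \<le> real (nat \<lfloor>real M * b\<rfloor>)"
      unfolding p(2) using mult_left_mono[of "z \<bullet> p" 1 "real (nat \<lfloor>real M * b\<rfloor>)"] by simp
    also have "\<dots> \<le> real M * b" using \<open>b > 0\<close> by simp
    finally have "z \<bullet> real_vec w \<le> real M * b" .
    moreover have "(\<Sum>j\<in>UNIV. (real M * d j - 1) * z $ j) \<le> z \<bullet> real_vec w"
      unfolding inner_vec_def real_vec_def
      by (intro sum_mono) (simp add: mult.commute[of "z $ _"] mult_right_mono w z(1))
    moreover have "(\<Sum>j\<in>UNIV. (real M * d j - 1) * z $ j) =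
        real M * (\<Sum>j\<in>UNIV. d j * z $ j) - (\<Sum>j\<in>UNIV. z $ j)"
      by (simp add: left_diff_distrib sum_subtractf sum_distrib_left mult.assoc)
    ultimately show ?thesis by (simp add: right_diff_distrib)
  qed
  then show False using reals_Archimedean3[OF gap] by (meson not_less)
qed

text \<open>Subsets of stable sets are stable, so the positive part of \<open>z\<close> obeys the
  same bounds and can be divided by \<open>r\<close>. For \<open>r = 0\<close> the singletons force
  it to vanish.\<close>

lemma perfect_scaled_antiblocker:
  fixes E :: "('n::finite \<times> 'n) set"
  assumes E: "simple_graph E" "perfect E"
    and z: "\<And>W. stable E W \<Longrightarrow> (\<Sum>j\<in>W. z $ j) \<le> r"
  shows "0 \<le> r \<and> (\<exists>v \<in> convex hull (rho ` {K. clique E K}). (\<chi> j. max 0 (z $ j)) = r *\<^sub>R v)"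
proof -
  define y :: "real ^ 'n" where "y = (\<chi> j. max 0 (z $ j))"
  have y: "(\<Sum>j\<in>W. y $ j) \<le> r" if "stable E W" for W
  proof -
    have "(\<Sum>j\<in>W. y $ j) = (\<Sum>j\<in>W \<inter> {j. z $ j > 0}. z $ j)"
      by (rule sum.mono_neutral_cong_right) (auto simp: y_def)
    then show ?thesis using z[OF stable_subset[OF that, of "W \<inter> {j. z $ j > 0}"]] by simp
  qed
  have y0: "0 \<le> y $ j" for j by (simp add: y_def)
  have "0 \<le> r" using z[of "{}"] by simp
  moreover have "\<exists>v \<in> convex hull (rho ` {K. clique E K}). y = r *\<^sub>R v"
  proof (cases "r = 0")
    case True
    have "y $ j = 0" for j using y[of "{j}"] y0[of j] True by (simp add: stable_def)
    then have "y = r *\<^sub>R rho {}" using True by (simp add: vec_eq_iff)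
    moreover have "rho {} \<in> convex hull (rho ` {K. clique E K})"
      by (intro hull_inc imageI) (simp add: clique_def)
    ultimately show ?thesis by blast
  next
    case False
    with \<open>0 \<le> r\<close> have "r > 0" by simp
    have "(1 / r) *\<^sub>R y \<in> convex hull (rho ` {K. clique E K})"
    proof (rule perfect_antiblocker[OF E])
      show "0 \<le> ((1 / r) *\<^sub>R y) $ j" for j using y0 \<open>r > 0\<close> by simp
      show "(\<Sum>j\<in>W. ((1 / r) *\<^sub>R y) $ j) \<le> 1" if "stable E W" for W
        using y[OF that] \<open>r > 0\<close> by (simp flip: sum_divide_distrib)
    qed
    moreover have "y = r *\<^sub>R (1 / r) *\<^sub>R y" using \<open>r > 0\<close> by simp
    ultimately show ?thesis by blast
  qed
  ultimately show ?thesis by (simp add: y_def)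
qed

text \<open>The clique inequality bounds the value by \<open>2 * a - (a - b) = a + b = 1\<close>,
  and the term from \<open>q\<close> can only lower it.\<close>

lemma inner_clique_Omega_le:
  assumes K: "clique E1 K"
    and y: "y \<in> Omega (stable_set_polytope E1) (stable_set_polytope E2)"
  shows "(2 *\<^sub>R rho K, -1) \<bullet> y \<le> 1"
proof -
  obtain a b p q where *: "0 \<le> a" "0 \<le> b" "a + b = 1"
    "p \<in> stable_set_polytope E1" "q \<in> stable_set_polytope E2" "y = (a *\<^sub>R p - b *\<^sub>R q, a - b)"
    using y unfolding mem_Omega_stable by (elim exE conjE) (rule that)
  have "rho K \<bullet> p \<le> 1" "0 \<le> rho K \<bullet> q"
    using stable_set_polytope_clique[OF *(4) K] stable_set_polytope_nth[OF *(5)]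
    by (simp_all add: inner_rho sum_nonneg)
  then have "a * (rho K \<bullet> p) \<le> a" "0 \<le> b * (rho K \<bullet> q)"
    using *(1,2) mult_left_mono[of "rho K \<bullet> p" 1 a] by simp_all
  then show ?thesis using *(3) by (simp add: *(6) inner_diff_right)
qed

text \<open>For \<open>(y, s)\<close> in the dual, the lifted stable sets bound the sums of
  \<open>y\<close> by \<open>1 - s\<close> and those of \<open>- y\<close> by \<open>1 + s\<close>.
  The antiblocker description then places the positive and negative parts of \<open>y\<close> in
  multiples of the two clique hulls.\<close>

lemma dual_Omega_perfect:
  fixes E1 E2 :: "('n::finite \<times> 'n) set"
  assumes G1: "simple_graph E1" "perfect E1" and G2: "simple_graph E2" "perfect E2"
  shows "dual_polytope (Omega (stable_set_polytope E1) (stable_set_polytope E2)) =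
    convex hull ((\<lambda>K. (2 *\<^sub>R rho K, -1)) ` {K. clique E1 K} \<union> (\<lambda>K. (- 2 *\<^sub>R rho K, 1)) ` {K. clique E2 K})"
    (is "dual_polytope ?P = convex hull ?V")
proof (rule antisym)
  have "?V \<subseteq> dual_polytope ?P"
  proof -
    show ?thesis
    proof
      fix v assume "v \<in> ?V"
      then consider K where "clique E1 K" "v = (2 *\<^sub>R rho K, -1)"
        | K where "clique E2 K" "v = (- 2 *\<^sub>R rho K, 1)" by blast
      then show "v \<in> dual_polytope ?P"
      proof cases
        case 1
        show ?thesis
          using inner_clique_Omega_le[OF 1(1), of _ E2] unfolding dual_polytope_def 1(2) by blast
      next
        case 2
        have "v \<bullet> y \<le> 1" if "y \<in> ?P" for y
        proof -
          have "- y \<in> Omega (stable_set_polytope E2) (stable_set_polytope E1)"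
            using that by (simp add: uminus_mem_Omega_stable)
          then have "(2 *\<^sub>R rho K, -1) \<bullet> (- y) \<le> 1" by (rule inner_clique_Omega_le[OF 2(1)])
          moreover have "v = - (2 *\<^sub>R rho K, -1)" using 2(2) by simp
          ultimately show ?thesis by (simp only: inner_minus_left inner_minus_right)
        qed
        then show ?thesis by (simp add: dual_polytope_def)
      qed
    qed
  qed
  moreover have "convex (dual_polytope ?P)"
  proof -
    have "dual_polytope ?P = (\<Inter>y\<in>?P. {x. y \<bullet> x \<le> 1})"
      unfolding dual_polytope_def by (subst inner_commute) blast
    then show ?thesis by (simp add: convex_INT convex_halfspace_le)
  qed
  ultimately show "convex hull ?V \<subseteq> dual_polytope ?P" by (rule hull_minimal)
next
  \<comment> \<open>An affine map that sends the clique vectors into \<open>?V\<close> sends their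
    hull into the hull of \<open>?V\<close>.\<close>
  have lift: "(f *\<^sub>R v, g) \<in> convex hull ?V"
    if "v \<in> convex hull (rho ` {K. clique E K})" "\<And>K. clique E K \<Longrightarrow> (f *\<^sub>R rho K, g) \<in> ?V" for v E f g
  proof -
    have "convex {v. (f *\<^sub>R v, g) \<in> convex hull ?V}"
    proof (rule convexI)
      fix x y :: "real ^ 'n" and s t :: real
      assume *: "x \<in> {v. (f *\<^sub>R v, g) \<in> convex hull ?V}" "y \<in> {v. (f *\<^sub>R v, g) \<in> convex hull ?V}"
        "0 \<le> s" "0 \<le> t" "s + t = 1"
      then have "s *\<^sub>R (f *\<^sub>R x, g) + t *\<^sub>R (f *\<^sub>R y, g) \<in> convex hull ?V"
        by (intro convexD[OF convex_convex_hull]) auto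
      moreover have "s * g + t * g = g" using *(5) by (metis distrib_right mult_1)
      then have "s *\<^sub>R (f *\<^sub>R x, g) + t *\<^sub>R (f *\<^sub>R y, g) = (f *\<^sub>R (s *\<^sub>R x + t *\<^sub>R y), g)"
        by (simp add: scaleR_add_right mult.commute[of f])
      ultimately show "s *\<^sub>R x + t *\<^sub>R y \<in> {v. (f *\<^sub>R v, g) \<in> convex hull ?V}" by simp
    qed
    moreover have "rho ` {K. clique E K} \<subseteq> {v. (f *\<^sub>R v, g) \<in> convex hull ?V}"
      using that(2) hull_inc by (metis (mono_tags, lifting) image_subsetI mem_Collect_eq)
    ultimately have "convex hull (rho ` {K. clique E K}) \<subseteq> {v. (f *\<^sub>R v, g) \<in> convex hull ?V}"
      by (intro hull_minimal)
    then show ?thesis using that(1) by blast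
  qed
  show "dual_polytope ?P \<subseteq> convex hull ?V"
  proof
    fix x assume dual: "x \<in> dual_polytope ?P"
    obtain y s where x: "x = (y, s)" by (cases x)
    have le: "(y, s) \<bullet> v \<le> 1" if "v \<in> ?P" for v
      using dual that unfolding dual_polytope_def x by blast
    have "(\<Sum>j\<in>W. y $ j) \<le> 1 - s" if "stable E1 W" for W
      using le[OF rho_mem_Omega[OF that]] by (simp add: inner_rho)
    from perfect_scaled_antiblocker[OF G1 this] obtain v where
      v: "0 \<le> 1 - s" "v \<in> convex hull (rho ` {K. clique E1 K})" "(\<chi> j. max 0 (y $ j)) = (1 - s) *\<^sub>R v"
      by auto
    have "(\<Sum>j\<in>W. (- y) $ j) \<le> 1 + s" if "stable E2 W" for W
      using le[OF minus_rho_mem_Omega[OF that]] by (simp add: inner_rho sum_negf)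
    from perfect_scaled_antiblocker[OF G2 this] obtain w where
      w: "0 \<le> 1 + s" "w \<in> convex hull (rho ` {K. clique E2 K})" "(\<chi> j. max 0 ((- y) $ j)) = (1 + s) *\<^sub>R w"
      by auto
    have "y = (1 - s) *\<^sub>R v - (1 + s) *\<^sub>R w"
      unfolding v(3)[symmetric] w(3)[symmetric] by (simp add: vec_eq_iff max_def)
    \<comment> \<open>The factor 2 in the vertices cancels the halves in the weights, and the
      weights are chosen so that the last coordinate is \<open>s\<close>.\<close>
    then have "x = ((1 - s) / 2) *\<^sub>R (2 *\<^sub>R v, -1) + ((1 + s) / 2) *\<^sub>R (- 2 *\<^sub>R w, 1)"
      by (intro prod_eqI) (simp_all add: x diff_divide_distrib add_divide_distrib)
    moreover have "((1 - s) / 2) *\<^sub>R (2 *\<^sub>R v, -1) + ((1 + s) / 2) *\<^sub>R (- 2 *\<^sub>R w, 1) \<in> convex hull ?V"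
    proof (rule convexD[OF convex_convex_hull])
      show "(2 *\<^sub>R v, -1) \<in> convex hull ?V" by (rule lift[OF v(2)]) blast
      show "(- 2 *\<^sub>R w, 1) \<in> convex hull ?V" by (rule lift[OF w(2)]) blast
    qed (use v(1) w(1) in \<open>simp_all add: field_simps\<close>)
    ultimately show "x \<in> convex hull ?V" by simp
  qed
qed

lemma perfect_imp_reflexive:
  fixes E1 E2 :: "('n::finite \<times> 'n) set"
  assumes "simple_graph E1" "perfect E1" "simple_graph E2" "perfect E2"
  shows "reflexive_polytope (Omega (stable_set_polytope E1) (stable_set_polytope E2))"
proof -
  let ?P = "Omega (stable_set_polytope E1) (stable_set_polytope E2)"
  let ?V = "(\<lambda>K. (2 *\<^sub>R rho K, -1)) ` {K. clique E1 K} \<union>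
    (\<lambda>K. (- 2 *\<^sub>R rho K, 1)) ` {K. clique E2 K} :: ((real ^ 'n) \<times> real) set"
  have "finite ?V" by simp
  moreover have "?V \<subseteq> integer_points"
    by (auto simp: integer_points_Pair_iff integer_points_vec_iff integer_points_real_iff)
  ultimately have "lattice_polytope (dual_polytope ?P)"
    unfolding dual_Omega_perfect[OF assms] lattice_polytope_def by blast
  moreover have "aff_dim ?P = int DIM((real ^ 'n) \<times> real)"
    using zero_interior_Omega by (intro aff_dim_nonempty_interior) blast
  ultimately show ?thesis
    unfolding reflexive_polytope_def using lattice_polytope_Omega zero_interior_Omega by blast
qed

theorem theorem1p1:
  fixes E1 E2 :: "('n::finite \<times> 'n) set"
  assumes "simple_graph E1" and "simple_graph E2"
  shows "let P = Omega (stable_set_polytope E1) (stable_set_polytope E2) in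
    (integer_decomposition_property P \<longleftrightarrow>
       reflexive_polytope P \<and> integer_decomposition_property P) \<and>
    (reflexive_polytope P \<and> integer_decomposition_property P \<longleftrightarrow>
       perfect E1 \<and> perfect E2)"
proof -
  let ?P = "Omega (stable_set_polytope E1) (stable_set_polytope E2)"
  have "perfect E1 \<and> perfect E2" if "integer_decomposition_property ?P"
    using perfect_if_integer_decomposition[OF assms(1) that]
      perfect_if_integer_decomposition[OF assms(2) integer_decomposition_property_Omega_swap[OF that]]
    by simp
  moreover have "reflexive_polytope ?P \<and> integer_decomposition_property ?P" if "perfect E1 \<and> perfect E2"
    using perfect_imp_reflexive perfect_imp_integer_decomposition assms that by blast
  ultimately show ?thesis unfolding Let_def by blast
qed

end
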